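(* Let $n\ge1$, $p,q>1$, let $\Theta\subset\mathbb{R}^{n+1}$ be open and bounded, let $\xi_0\in\partial\Theta$, and let $B\subset\mathbb{R}^{n+1}$ be any (open Euclidean) ball containing $\xi_0$. Then, for the equation $\partial_t u=\Delta_p^q u$, the point $\xi_0$ is regular with respect to $\Theta$ if and only if $\xi_0$ is regular with respect to $\Theta\cap B$.
   Context: Equation. Points of $\mathbb{R}^{n+1}$ are written $(x,t)$, and $\nabla$, $\Delta$, $D^2$ act in $x$ only. The equation is (E): $\partial_t u=\Delta_p^q u$, where for $\nabla u\neq 0$, $\Delta_p^q u=|\nabla u|^{q-p}\operatorname{div}(|\nabla u|^{p-2}\nabla u)=F(\nabla u,D^2u)$ with $F(\eta,X)=|\eta|^{q-2}\operatorname{Tr}\big(X+(p-2)\tfrac{\eta\otimes\eta}{|\eta|^2}X\big)$ for $\eta\in\mathbb{R}^n\setminus\{0\}$ and $X$ a symmetric $n\times n$ matrix. Below $\Theta$ stands for any bounded open subset of $\mathbb{R}^{n+1}$. Admissible functions. $\mathcal{F}(F)$ is the set of $f\in C^2([0,\infty))$ with $f(0)=f'(0)=f''(0)=0$, $f''(r)>0$ for all $r>0$, and $\lim_{x\to 0,\,x\ne 0}F(\nabla g(x),D^2g(x))=0$ for $g(x)=f(|x|)$. $\Sigma$ is the set of even $\sigma\in C^1(\mathbb{R})$ with $\sigma(0)=\sigma'(0)=0$ and $\sigma(r)>0$ for $r>0$. A function $\varphi\in C^2(\Theta)$ is admissible at $(x_0,t_0)\in\Theta$ if either $\nabla\varphi(x_0,t_0)\ne0$,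 or there are $\delta>0$, $f\in\mathcal{F}(F)$, $\sigma\in\Sigma$ such that $|\varphi(x,t)-\varphi(x_0,t_0)-\partial_t\varphi(x_0,t_0)(t-t_0)|\le f(|x-x_0|)+\sigma(t-t_0)$ for all $(x,t)\in B_\delta(x_0)\times(t_0-\delta,t_0+\delta)$. Viscosity supersolutions. $u:\Theta\to\mathbb{R}\cup\{\infty\}$ is a viscosity supersolution of (E) in $\Theta$ if (1) $u$ is lower semicontinuous; (2) $u$ is finite in a dense subset of $\Theta$; (3) whenever $\varphi\in C^2(\Theta)$ is admissible at $\xi\in\Theta$ and touches $u$ at $\xi$ from below (i.e. $\varphi(\xi)=u(\xi)$ and $\varphi<u$ in a punctured neighborhood of $\xi$), then $\partial_t\varphi(\xi)-\Delta_p^q\varphi(\xi)\ge0$ if $\nabla\varphi(\xi)\ne0$, and $\partial_t\varphi(\xi)\ge0$ if $\nabla\varphi(\xi)=0$. Perron solutions and regularity. For bounded $f:\partial\Theta\to\mathbb{R}$, $\mathcal{U}_f$ is the class of viscosity supersolutions $u$ of (E) in $\Theta$ that are bounded from below and satisfy $\liminf_{\Theta\ni\eta\to\xi}u(\eta)\ge f(\xi)$ for all $\xi\in\partial\Theta$; the upper Perron solution is $\overline{H}f(\xi)=\inf_{u\in\mathcal{U}_f}u(\xi)$, $\xi\in\Theta$. A point $\xi_0\in\partial\Theta$ is regular (with respect to $\Theta$) if $\lim_{\Theta\ni\xi\to\xi_0}\overline{H}f(\xi)=f(\xi_0)$ for every $f\in C(\partial\Theta)$. *)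

theory Defs
  imports "HOL-Analysis.Analysis"
begin

section \<open>Derivatives\<close>

definition grad :: "(real ^ 'n \<Rightarrow> real) \<Rightarrow> real ^ 'n \<Rightarrow> real ^ 'n" where
  "grad f x = (\<chi> i. frechet_derivative f (at x) (axis i 1))"

definition hess :: "(real ^ 'n \<Rightarrow> real) \<Rightarrow> real ^ 'n \<Rightarrow> real ^ 'n ^ 'n" where
  "hess f x = jacobian (grad f) (at x)"

definition divergence :: "(real ^ 'n \<Rightarrow> real ^ 'n) \<Rightarrow> real ^ 'n \<Rightarrow> real" where
  "divergence V x = trace (jacobian V (at x))"

definition outer :: "real ^ 'n \<Rightarrow> real ^ 'n \<Rightarrow> real ^ 'n ^ 'n" where
  "outer v w = (\<chi> i j. v $ i * w $ j)"

text \<open>Twice continuously differentiable on an open set: the gradient exists and is itself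
  continuously Frechet differentiable.\<close>

definition C2_on :: "'a::euclidean_space set \<Rightarrow> ('a \<Rightarrow> real) \<Rightarrow> bool" where
  "C2_on S f \<longleftrightarrow> (\<exists>(G :: 'a \<Rightarrow> 'a) (H :: 'a \<Rightarrow> 'a \<Rightarrow>\<^sub>L 'a).
     (\<forall>x\<in>S. GDERIV f x :> G x) \<and>
     (\<forall>x\<in>S. (G has_derivative blinfun_apply (H x)) (at x)) \<and>
     continuous_on S H)"


section \<open>The equation\<close>

text \<open>Points of space-time are pairs in \<open>(real ^ 'n) \<times> real\<close>, whose norm is the Euclidean one.\<close>

definition F_pq :: "real \<Rightarrow> real \<Rightarrow> real ^ 'n \<Rightarrow> real ^ 'n ^ 'n \<Rightarrow> real" where
  "F_pq p q \<eta> X = norm \<eta> powr (q - 2) *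
     trace (X + (p - 2) *\<^sub>R (((1 / (norm \<eta>)\<^sup>2) *\<^sub>R outer \<eta> \<eta>) ** X))"

definition Delta_pq :: "real \<Rightarrow> real \<Rightarrow> (real ^ 'n \<Rightarrow> real) \<Rightarrow> real ^ 'n \<Rightarrow> real" where
  "Delta_pq p q f x = norm (grad f x) powr (q - p) *
     divergence (\<lambda>y. norm (grad f y) powr (p - 2) *\<^sub>R grad f y) x"

definition dt :: "((real ^ 'n) \<times> real \<Rightarrow> real) \<Rightarrow> (real ^ 'n) \<times> real \<Rightarrow> real" where
  "dt \<phi> \<xi> = deriv (\<lambda>t. \<phi> (fst \<xi>, t)) (snd \<xi>)"

definition grad_x :: "((real ^ 'n) \<times> real \<Rightarrow> real) \<Rightarrow> (real ^ 'n) \<times> real \<Rightarrow> real ^ 'n" where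
  "grad_x \<phi> \<xi> = grad (\<lambda>x. \<phi> (x, snd \<xi>)) (fst \<xi>)"

definition Delta_pq_x ::
    "real \<Rightarrow> real \<Rightarrow> ((real ^ 'n) \<times> real \<Rightarrow> real) \<Rightarrow> (real ^ 'n) \<times> real \<Rightarrow> real" where
  "Delta_pq_x p q \<phi> \<xi> = Delta_pq p q (\<lambda>x. \<phi> (x, snd \<xi>)) (fst \<xi>)"

lemma Delta_pq_eq_F_pq:
  fixes f :: "real ^ 'n \<Rightarrow> real"
  assumes diff: "grad f differentiable (at x)" and nz: "grad f x \<noteq> 0"
  shows "Delta_pq p q f x = F_pq p q (grad f x) (hess f x)"
proof -
  define \<eta> where "\<eta> = grad f x"
  define X where "X = hess f x"
  define a where "a = norm \<eta>"
  have a: "a > 0" using nz by (simp add: a_def \<eta>_def)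
  have G: "(grad f has_derivative (\<lambda>h. X *v h)) (at x)"
    using diff jacobian_works unfolding X_def hess_def by blast
  have N: "((\<lambda>y. norm (grad f y)) has_derivative (\<lambda>h. (X *v h) \<bullet> (\<eta> /\<^sub>R a))) (at x)"
    using has_derivative_compose[OF G has_derivative_norm[of "grad f x"]] nz
    by (simp add: \<eta>_def a_def sgn_div_norm inner_commute)
  have P: "((\<lambda>y. norm (grad f y) powr (p - 2)) has_derivative
      (\<lambda>h. ((p - 2) * a powr (p - 3)) * ((X *v h) \<bullet> (\<eta> /\<^sub>R a)))) (at x)"
    by (rule has_derivative_eq_rhs, rule has_derivative_compose[OF N, where g="\<lambda>s. s powr (p-2)" and g'="\<lambda>s. ((p - 2) * a powr (p - 3)) * s"])
       (use a has_real_derivative_powr[of a "p-2"] in \<open>auto simp: a_def \<eta>_def has_field_derivative_def\<close>)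
  have V: "((\<lambda>y. norm (grad f y) powr (p - 2) *\<^sub>R grad f y) has_derivative
      (\<lambda>h. a powr (p - 2) *\<^sub>R (X *v h) + (((p - 2) * a powr (p - 3)) * ((X *v h) \<bullet> (\<eta> /\<^sub>R a))) *\<^sub>R \<eta>)) (at x)"
    using has_derivative_scaleR[OF P G] by (simp add: a_def \<eta>_def)
  have col: "(X *v axis i 1) $ j = X $ j $ i" for i j
    by (simp add: matrix_vector_mult_basis column_def)
  define S where "S = (\<Sum>i\<in>UNIV. \<Sum>k\<in>UNIV. \<eta> $ i * \<eta> $ k * X $ k $ i)"
  have "divergence (\<lambda>y. norm (grad f y) powr (p - 2) *\<^sub>R grad f y) x
      = (\<Sum>i\<in>UNIV. a powr (p - 2) * X $ i $ i + ((p - 2) * a powr (p - 3)) * (\<Sum>k\<in>UNIV. X $ k $ i * \<eta> $ k / a) * \<eta> $ i)"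
    unfolding divergence_def jacobian_def trace_def matrix_def frechet_derivative_at[OF V, symmetric]
    by (simp add: col inner_vec_def divide_inverse mult_ac)
  also have "\<dots> = a powr (p - 2) * trace X + (p - 2) * (a powr (p - 3) / a) * S"
    unfolding S_def trace_def
    by (simp add: sum.distrib sum_distrib_left sum_distrib_right mult_ac)
  also have "a powr (p - 3) / a = a powr (p - 4)"
    using a powr_diff[of a "p-3" 1] by simp
  finally have D: "Delta_pq p q f x = a powr (q - p) * (a powr (p - 2) * trace X + (p - 2) * a powr (p - 4) * S)"
    by (simp add: Delta_pq_def a_def \<eta>_def)
  have e: "a powr (q - p) * a powr (p - 2) = a powr (q - 2)"
    "a powr (q - p) * a powr (p - 4) = a powr (q - 2) / a\<^sup>2"
    using a powr_diff[of a "q-2" 2] by (simp_all flip: powr_add)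
  have T: "trace (X + (p - 2) *\<^sub>R (((1 / a\<^sup>2) *\<^sub>R outer \<eta> \<eta>) ** X)) = trace X + (p - 2) / a\<^sup>2 * S"
    unfolding trace_def S_def outer_def matrix_matrix_mult_def
    by (simp add: sum.distrib sum_distrib_left mult_ac)
  show ?thesis
    unfolding D F_pq_def \<eta>_def[symmetric] X_def[symmetric] a_def[symmetric] T
    by (simp add: distrib_left e mult.assoc[symmetric]) (simp add: e mult.assoc mult.left_commute[of "a powr (q - p)"])
qed


section \<open>Admissible functions\<close>

text \<open>\<open>radial_class F\<close> is the class \<open>\<F>(F)\<close>; only the values of \<open>f\<close> on \<open>[0, \<infinity>)\<close> matter, and the
  derivatives at \<open>0\<close> are one-sided.\<close>

definition radial_class :: "(real ^ 'n \<Rightarrow> real ^ 'n ^ 'n \<Rightarrow> real) \<Rightarrow> (real \<Rightarrow> real) set" where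
  "radial_class F = {f. \<exists>f' f''.
     (\<forall>r\<ge>0. (f has_real_derivative f' r) (at r within {0..})) \<and>
     (\<forall>r\<ge>0. (f' has_real_derivative f'' r) (at r within {0..})) \<and>
     continuous_on {0..} f'' \<and>
     f 0 = 0 \<and> f' 0 = 0 \<and> f'' 0 = 0 \<and> (\<forall>r>0. f'' r > 0) \<and>
     ((\<lambda>x. F (grad (\<lambda>y. f (norm y)) x) (hess (\<lambda>y. f (norm y)) x)) \<longlongrightarrow> 0) (at 0)}"

definition Sigma_class :: "(real \<Rightarrow> real) set" where
  "Sigma_class = {\<sigma>. \<sigma> C1_differentiable_on UNIV \<and> (\<forall>r. \<sigma> (- r) = \<sigma> r) \<and>
     \<sigma> 0 = 0 \<and> deriv \<sigma> 0 = 0 \<and> (\<forall>r>0. \<sigma> r > 0)}"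

text \<open>The cylinder is required to lie in \<open>\<Theta>\<close>, where \<open>\<phi>\<close> is defined.\<close>

definition admissible_at ::
    "real \<Rightarrow> real \<Rightarrow> ((real ^ 'n) \<times> real) set \<Rightarrow> ((real ^ 'n) \<times> real \<Rightarrow> real) \<Rightarrow> (real ^ 'n) \<times> real \<Rightarrow> bool"
  where
  "admissible_at p q \<Theta> \<phi> \<xi> \<longleftrightarrow> grad_x \<phi> \<xi> \<noteq> 0 \<or>
     (\<exists>\<delta>>0. \<exists>f \<in> radial_class (F_pq p q :: real ^ 'n \<Rightarrow> real ^ 'n ^ 'n \<Rightarrow> real).
      \<exists>\<sigma> \<in> Sigma_class.
        ball (fst \<xi>) \<delta> \<times> {snd \<xi> - \<delta> <..< snd \<xi> + \<delta>} \<subseteq> \<Theta> \<and>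
        (\<forall>x \<in> ball (fst \<xi>) \<delta>. \<forall>t \<in> {snd \<xi> - \<delta> <..< snd \<xi> + \<delta>}.
          \<bar>\<phi> (x, t) - \<phi> \<xi> - dt \<phi> \<xi> * (t - snd \<xi>)\<bar> \<le> f (norm (x - fst \<xi>)) + \<sigma> (t - snd \<xi>)))"


section \<open>Viscosity supersolutions\<close>

definition touches_from_below ::
    "'a::metric_space set \<Rightarrow> ('a \<Rightarrow> real) \<Rightarrow> ('a \<Rightarrow> ereal) \<Rightarrow> 'a \<Rightarrow> bool" where
  "touches_from_below \<Theta> \<phi> u \<xi> \<longleftrightarrow>
     ereal (\<phi> \<xi>) = u \<xi> \<and> (\<forall>\<^sub>F \<eta> in at \<xi> within \<Theta>. ereal (\<phi> \<eta>) < u \<eta>)"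

text \<open>Functions on \<open>\<Theta>\<close> are total functions of which only the values on \<open>\<Theta>\<close> matter.\<close>

definition viscosity_supersolution ::
    "real \<Rightarrow> real \<Rightarrow> ((real ^ 'n) \<times> real) set \<Rightarrow> ((real ^ 'n) \<times> real \<Rightarrow> ereal) \<Rightarrow> bool" where
  "viscosity_supersolution p q \<Theta> u \<longleftrightarrow>
     (\<forall>\<xi>\<in>\<Theta>. u \<xi> \<noteq> - \<infinity>) \<and>
     (\<forall>\<xi>\<in>\<Theta>. u \<xi> \<le> Liminf (at \<xi> within \<Theta>) u) \<and>
     \<Theta> \<subseteq> closure {\<xi>\<in>\<Theta>. u \<xi> \<noteq> \<infinity>} \<and>
     (\<forall>\<phi>. \<forall>\<xi>\<in>\<Theta>. C2_on \<Theta> \<phi> \<and> admissible_at p q \<Theta> \<phi> \<xi> \<and> touches_from_below \<Theta> \<phi> u \<xi> \<longrightarrow>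
        (if grad_x \<phi> \<xi> \<noteq> 0 then dt \<phi> \<xi> - Delta_pq_x p q \<phi> \<xi> \<ge> 0 else dt \<phi> \<xi> \<ge> 0))"


section \<open>Perron solutions and regularity\<close>

definition upper_class ::
    "real \<Rightarrow> real \<Rightarrow> ((real ^ 'n) \<times> real) set \<Rightarrow> ((real ^ 'n) \<times> real \<Rightarrow> real) \<Rightarrow>
      ((real ^ 'n) \<times> real \<Rightarrow> ereal) set" where
  "upper_class p q \<Theta> f = {u. viscosity_supersolution p q \<Theta> u \<and>
     (\<exists>m::real. \<forall>\<xi>\<in>\<Theta>. ereal m \<le> u \<xi>) \<and>
     (\<forall>\<xi>\<in>frontier \<Theta>. ereal (f \<xi>) \<le> Liminf (at \<xi> within \<Theta>) u)}"

definition upper_perron ::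
    "real \<Rightarrow> real \<Rightarrow> ((real ^ 'n) \<times> real) set \<Rightarrow> ((real ^ 'n) \<times> real \<Rightarrow> real) \<Rightarrow>
      (real ^ 'n) \<times> real \<Rightarrow> ereal" where
  "upper_perron p q \<Theta> f \<xi> = (INF u \<in> upper_class p q \<Theta> f. u \<xi>)"

definition regular_point ::
    "real \<Rightarrow> real \<Rightarrow> ((real ^ 'n) \<times> real) set \<Rightarrow> (real ^ 'n) \<times> real \<Rightarrow> bool" where
  "regular_point p q \<Theta> \<xi>0 \<longleftrightarrow> \<xi>0 \<in> frontier \<Theta> \<and>
     (\<forall>f. continuous_on (frontier \<Theta>) f \<longrightarrow>
        (upper_perron p q \<Theta> f \<longlongrightarrow> ereal (f \<xi>0)) (at \<xi>0 within \<Theta>))"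

end

theory Submission
  imports Defs
begin

text \<open>The idea is to localize with the explicit function
  \<open>V (x, t) = A (exp \<bar>x - x\<^sub>0\<bar>\<^sub>\<infinity> - 1) + B \<bar>t - t\<^sub>0\<bar>\<close>, which vanishes at \<open>\<xi>\<^sub>0\<close> and is as large as
  desired away from it. It is a maximum of smooth ramps
  \<open>A (exp (\<plusminus>(x - x\<^sub>0)\<^sub>i) - 1) \<plusminus> B (t - t\<^sub>0)\<close> with nonvanishing gradient, which are strict
  subsolutions on \<open>\<Theta>\<close> once \<open>A\<close> is large compared with \<open>B\<close>; here \<open>p, q > 1\<close> enters. Hence \<open>c - V\<close> is
  a supersolution, and comparing with one ramp at a time shows that a supersolution lying above
  \<open>c + V\<close> on the boundary lies above it inside. No comparison principle between two viscosity
  solutions is needed.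

  Given boundary data \<open>f\<close> on one of \<open>\<Theta>\<close>, \<open>\<Theta> \<inter> B\<close>, choose \<open>V\<close> so that
  \<open>f(\<xi>\<^sub>0) - \<epsilon> - V \<le> f \<le> f(\<xi>\<^sub>0) + \<epsilon> + V\<close>. Restricting supersolutions, or pasting them as a minimum with
  \<open>f(\<xi>\<^sub>0) - \<epsilon> - V\<close> or a constant, bounds the Perron solution of \<open>f\<close> near \<open>\<xi>\<^sub>0\<close> by those of
  \<open>f(\<xi>\<^sub>0) \<plusminus> (\<epsilon> + V)\<close> on the other set, whose limits at \<open>\<xi>\<^sub>0\<close> are known by regularity.\<close>

section \<open>Twice differentiable functions\<close>

text \<open>Gradient and Hessian are explicit arguments, so that the rules below compute them.
  Continuity of the second derivative is asked direction by direction; in finite dimension this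
  amounts to continuity in operator norm, and it spares the sum, product and chain rules any work
  with bounded linear maps.\<close>

definition C2_jet ::
    "'a::euclidean_space set \<Rightarrow> ('a \<Rightarrow> real) \<Rightarrow> ('a \<Rightarrow> 'a) \<Rightarrow> ('a \<Rightarrow> 'a \<Rightarrow> 'a) \<Rightarrow> bool" where
  "C2_jet S f G H \<longleftrightarrow> (\<forall>x\<in>S. GDERIV f x :> G x) \<and> (\<forall>x\<in>S. (G has_derivative H x) (at x)) \<and>
     (\<forall>h. continuous_on S (\<lambda>x. H x h))"

lemma C2_jetD:
  assumes "C2_jet S f G H" "x \<in> S"
  shows "(f has_derivative (\<lambda>h. h \<bullet> G x)) (at x)" "(G has_derivative H x) (at x)"
  using assms by (auto simp: C2_jet_def gderiv_def)

lemma C2_jet_continuous: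
  assumes "C2_jet S f G H"
  shows "continuous_on S f" "continuous_on S G" "continuous_on S (\<lambda>x. H x h)"
  using assms C2_jetD[OF assms]
  by (auto simp: C2_jet_def intro!: continuous_at_imp_continuous_on has_derivative_continuous)

lemma C2_on_iff_C2_jet: "C2_on S f \<longleftrightarrow> (\<exists>G H. C2_jet S f G H)"
proof
  assume "C2_on S f"
  then obtain G H where *: "\<forall>x\<in>S. GDERIV f x :> G x"
      "\<forall>x\<in>S. (G has_derivative blinfun_apply (H x)) (at x)" "continuous_on S H"
    unfolding C2_on_def by blast
  have "C2_jet S f G (\<lambda>x. blinfun_apply (H x))"
    using * by (auto simp: C2_jet_def intro!: continuous_intros)
  then show "\<exists>G H. C2_jet S f G H" by blast
next
  assume "\<exists>G H. C2_jet S f G H"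
  then obtain G H where *: "C2_jet S f G H" by blast
  let ?H = "\<lambda>x. Blinfun (H x)"
  have eq: "blinfun_apply (?H x) = H x" if "x \<in> S" for x
    using C2_jetD(2)[OF * that] by (simp add: bounded_linear_Blinfun_apply has_derivative_bounded_linear)
  have "continuous_on S ?H"
  proof (rule continuous_on_blinfun_componentwise)
    fix i :: 'a
    show "continuous_on S (\<lambda>x. blinfun_apply (?H x) i)"
      using C2_jet_continuous(3)[OF *, of i] by (rule continuous_on_eq) (simp add: eq)
  qed
  moreover have "\<forall>x\<in>S. (G has_derivative blinfun_apply (?H x)) (at x)"
    using C2_jetD(2)[OF *] eq by simp
  ultimately show "C2_on S f"
    using * unfolding C2_on_def C2_jet_def by (intro exI[of _ G] exI[of _ ?H]) auto
qed

lemma C2_jet_subset: "C2_jet S f G H \<Longrightarrow> T \<subseteq> S \<Longrightarrow> C2_jet T f G H"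
  unfolding C2_jet_def by (meson continuous_on_subset subsetD)

lemma C2_jet_cong:
  assumes "C2_jet S f G H" "open S" "\<And>x. x \<in> S \<Longrightarrow> f x = g x"
  shows "C2_jet S g G H"
  using assms unfolding C2_jet_def gderiv_def
  by (metis has_derivative_transform_within_open)

text \<open>First and second derivatives are unique, so the two pairs of witnesses agree on the
  overlap and glue; openness makes differentiability and continuity local.\<close>

lemma C2_on_Un:
  assumes f: "C2_on S f" "C2_on T f" and o: "open S" "open T"
  shows "C2_on (S \<union> T) f"
proof -
  obtain G1 H1 G2 H2 where *: "C2_jet S f G1 H1" "C2_jet T f G2 H2"
    using f unfolding C2_on_iff_C2_jet by blast
  have G: "G1 x = G2 x" if "x \<in> S \<inter> T" for x
  proof -
    have "(\<lambda>h. h \<bullet> G1 x) = (\<lambda>h. h \<bullet> G2 x)"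
      using that C2_jetD(1)[OF *(1), of x] C2_jetD(1)[OF *(2), of x] by (auto intro: has_derivative_unique)
    from fun_cong[OF this, of "G1 x - G2 x"] have "(G1 x - G2 x) \<bullet> (G1 x - G2 x) = 0"
      by (simp add: inner_diff_right)
    then show ?thesis by simp
  qed
  have H: "H1 x = H2 x" if "x \<in> S \<inter> T" for x
  proof (rule has_derivative_unique)
    show "(G1 has_derivative H1 x) (at x)" using *(1) that by (simp add: C2_jetD)
    have "(G2 has_derivative H2 x) (at x)" using *(2) that by (simp add: C2_jetD)
    then show "(G1 has_derivative H2 x) (at x)"
      by (rule has_derivative_transform_within_open[OF _ open_Int[OF o] that]) (rule G[symmetric])
  qed
  define G where "G x = (if x \<in> S then G1 x else G2 x)" for x
  define H where "H x = (if x \<in> S then H1 x else H2 x)" for x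
  have S: "G x = G1 x" "H x = H1 x" if "x \<in> S" for x using that by (auto simp: G_def H_def)
  have T: "G x = G2 x" "H x = H2 x" if "x \<in> T" for x using that G H by (auto simp: G_def H_def)
  have "(G has_derivative H x) (at x)" if "x \<in> S \<union> T" for x
  proof (cases "x \<in> S")
    case True
    show ?thesis
      by (rule has_derivative_transform_within_open[OF _ o(1) True])
        (use C2_jetD(2)[OF *(1) True] S True in auto)
  next
    case False
    with that have x: "x \<in> T" by simp
    show ?thesis
      by (rule has_derivative_transform_within_open[OF _ o(2) x])
        (use C2_jetD(2)[OF *(2) x] T x in auto)
  qed
  moreover have "continuous_on (S \<union> T) (\<lambda>x. H x h)" for h
  proof (rule continuous_on_open_Un[OF o])
    show "continuous_on S (\<lambda>x. H x h)"
      using C2_jet_continuous(3)[OF *(1), of h] by (rule continuous_on_eq) (simp add: S)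
    show "continuous_on T (\<lambda>x. H x h)"
      using C2_jet_continuous(3)[OF *(2), of h] by (rule continuous_on_eq) (simp add: T)
  qed
  moreover have "\<forall>x\<in>S \<union> T. GDERIV f x :> G x"
    using * S T by (auto simp: C2_jet_def)
  ultimately have "C2_jet (S \<union> T) f G H" by (simp add: C2_jet_def)
  then show ?thesis unfolding C2_on_iff_C2_jet by blast
qed

lemma C2_jet_const: "C2_jet S (\<lambda>x. c) (\<lambda>x. 0) (\<lambda>x h. 0)"
  by (auto simp: C2_jet_def gderiv_def)

lemma C2_jet_inner: "C2_jet S (\<lambda>x. x \<bullet> a) (\<lambda>x. a) (\<lambda>x h. 0)"
  by (auto simp: C2_jet_def gderiv_def intro!: derivative_eq_intros)

lemma C2_jet_dist_square: "C2_jet S (\<lambda>x. (x - a) \<bullet> (x - a)) (\<lambda>x. 2 *\<^sub>R (x - a)) (\<lambda>x h. 2 *\<^sub>R h)"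
  unfolding C2_jet_def gderiv_def
  by (auto intro!: derivative_eq_intros continuous_intros simp: inner_commute)

lemma C2_jet_add:
  assumes "C2_jet S f G H" "C2_jet S f' G' H'"
  shows "C2_jet S (\<lambda>x. f x + f' x) (\<lambda>x. G x + G' x) (\<lambda>x h. H x h + H' x h)"
  using assms unfolding C2_jet_def gderiv_def
  by (auto intro!: derivative_eq_intros continuous_intros simp: inner_add_right)

lemma C2_jet_mult:
  assumes "C2_jet S f G H" "C2_jet S f' G' H'"
  shows "C2_jet S (\<lambda>x. f x * f' x) (\<lambda>x. f x *\<^sub>R G' x + f' x *\<^sub>R G x)
    (\<lambda>x h. f x *\<^sub>R H' x h + (h \<bullet> G x) *\<^sub>R G' x + (f' x *\<^sub>R H x h + (h \<bullet> G' x) *\<^sub>R G x))"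
proof -
  have "((\<lambda>x. f x * f' x) has_derivative (\<lambda>h. h \<bullet> (f x *\<^sub>R G' x + f' x *\<^sub>R G x))) (at x)" if "x \<in> S" for x
    by (rule has_derivative_eq_rhs[OF has_derivative_mult[OF C2_jetD(1)[OF assms(1) that] C2_jetD(1)[OF assms(2) that]]])
      (simp add: inner_add_right mult.commute)
  moreover have "((\<lambda>x. f x *\<^sub>R G' x + f' x *\<^sub>R G x) has_derivative
      (\<lambda>h. f x *\<^sub>R H' x h + (h \<bullet> G x) *\<^sub>R G' x + (f' x *\<^sub>R H x h + (h \<bullet> G' x) *\<^sub>R G x))) (at x)"
    if "x \<in> S" for x
    using that C2_jetD[OF assms(1)] C2_jetD[OF assms(2)]
    by (intro has_derivative_add has_derivative_scaleR) auto
  moreover have "continuous_on S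
      (\<lambda>x. f x *\<^sub>R H' x h + (h \<bullet> G x) *\<^sub>R G' x + (f' x *\<^sub>R H x h + (h \<bullet> G' x) *\<^sub>R G x))" for h
    by (intro continuous_intros assms[THEN C2_jet_continuous(1)] assms[THEN C2_jet_continuous(2)]
        assms[THEN C2_jet_continuous(3)])
  ultimately show ?thesis by (simp add: C2_jet_def gderiv_def)
qed

lemma C2_jet_compose:
  assumes f: "C2_jet S f G H"
    and g: "\<And>y. (g has_real_derivative g' y) (at y)" "\<And>y. (g' has_real_derivative g'' y) (at y)"
      "continuous_on UNIV g''"
  shows "C2_jet S (\<lambda>x. g (f x)) (\<lambda>x. g' (f x) *\<^sub>R G x)
    (\<lambda>x h. g' (f x) *\<^sub>R H x h + (g'' (f x) * (h \<bullet> G x)) *\<^sub>R G x)"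
proof -
  note c = C2_jet_continuous[OF f]
  have g': "continuous_on UNIV g'"
    using g(2) by (meson DERIV_isCont continuous_at_imp_continuous_on)
  have cc: "continuous_on S (\<lambda>x. g' (f x))" "continuous_on S (\<lambda>x. g'' (f x))"
    using continuous_on_compose2[OF g' c(1)] continuous_on_compose2[OF g(3) c(1)] by auto
  have d: "((\<lambda>x. k (f x)) has_derivative (\<lambda>h. k' (f x) * (h \<bullet> G x))) (at x)"
    if "x \<in> S" "\<And>y. (k has_real_derivative k' y) (at y)" for k k' x
    using has_derivative_compose[OF C2_jetD(1)[OF f that(1)], of k] that(2)[of "f x"]
    by (simp add: has_field_derivative_def)
  have "((\<lambda>x. g (f x)) has_derivative (\<lambda>h. h \<bullet> (g' (f x) *\<^sub>R G x))) (at x)" if "x \<in> S" for x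
    using d[where k=g and k'=g', OF that g(1)] by simp
  moreover have "((\<lambda>x. g' (f x) *\<^sub>R G x) has_derivative
      (\<lambda>h. g' (f x) *\<^sub>R H x h + (g'' (f x) * (h \<bullet> G x)) *\<^sub>R G x)) (at x)" if "x \<in> S" for x
    by (intro has_derivative_scaleR d[where k=g' and k'=g'', OF that g(2)] C2_jetD(2)[OF f that])
  moreover have "continuous_on S (\<lambda>x. g' (f x) *\<^sub>R H x h + (g'' (f x) * (h \<bullet> G x)) *\<^sub>R G x)" for h
    by (intro continuous_intros c cc)
  ultimately show ?thesis by (simp add: C2_jet_def gderiv_def)
qed

text \<open>The second-order condition is proved along the line through \<open>x\<close> in
  direction \<open>h\<close>: were the second derivative there positive, the first derivative, which
  vanishes at \<open>x\<close>, would be positive just after \<open>x\<close>, and the mean value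
  theorem would make \<open>f\<close> exceed \<open>f x\<close>.\<close>

lemma C2_jet_local_max:
  assumes f: "C2_jet S f G H" and S: "open S" "x \<in> S"
    and max: "\<And>y. y \<in> S \<Longrightarrow> f y \<le> f x"
  shows "G x = 0" "H x h \<bullet> h \<le> 0"
proof -
  have "(\<lambda>h. h \<bullet> G x) = (\<lambda>h. 0)"
    by (rule has_derivative_local_max[OF C2_jetD(1)[OF f S(2)]])
      (use S max in \<open>auto simp: eventually_at_filter eventually_nhds\<close>)
  from fun_cong[OF this, of "G x"] show G0: "G x = 0" by simp
  show "H x h \<bullet> h \<le> 0"
  proof (rule ccontr)
    assume "\<not> H x h \<bullet> h \<le> 0"
    then have pos: "H x h \<bullet> h > 0" by simp
    define \<gamma> where "\<gamma> s = x + s *\<^sub>R h" for s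
    have \<gamma>: "(\<gamma> has_derivative (\<lambda>u. u *\<^sub>R h)) (at s)" for s
      unfolding \<gamma>_def by (auto intro!: derivative_eq_intros)
    have d1: "((\<lambda>s. f (\<gamma> s)) has_real_derivative (h \<bullet> G (\<gamma> s))) (at s)" if "\<gamma> s \<in> S" for s
      using has_derivative_compose[OF \<gamma> C2_jetD(1)[OF f that]]
      by (rule has_derivative_imp_has_field_derivative) simp
    have "((\<lambda>s. G (\<gamma> s)) has_derivative (\<lambda>u. H x (u *\<^sub>R h))) (at 0)"
      using has_derivative_compose[OF \<gamma>, of G "H x" 0] C2_jetD(2)[OF f S(2)] by (simp add: \<gamma>_def)
    from has_derivative_inner_right[OF this, of h]
    have "((\<lambda>s. h \<bullet> G (\<gamma> s)) has_real_derivative (H x h \<bullet> h)) (at 0)"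
      using linear_scale[OF has_derivative_linear[OF C2_jetD(2)[OF f S(2)]]]
      by (intro has_derivative_imp_has_field_derivative) (auto simp: inner_commute)
    from DERIV_pos_inc_right[OF this pos] obtain d where d: "d > 0"
      "\<And>s. 0 < s \<Longrightarrow> s < d \<Longrightarrow> h \<bullet> G (\<gamma> 0) < h \<bullet> G (\<gamma> s)" by auto
    have "isCont \<gamma> 0" using \<gamma> has_derivative_continuous by blast
    then have "\<forall>\<^sub>F s in at 0. \<gamma> s \<in> S"
      using S topological_tendstoD[of \<gamma> "\<gamma> 0" "at 0" S] by (simp add: isCont_def \<gamma>_def)
    then obtain d' where d': "d' > 0" "\<And>s. s \<noteq> 0 \<Longrightarrow> \<bar>s\<bar> < d' \<Longrightarrow> \<gamma> s \<in> S"
      by (auto simp: eventually_at dist_real_def)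
    define s where "s = min d d' / 2"
    have s: "0 < s" "s < d" "s < d'" using d(1) d'(1) by (auto simp: s_def)
    have in_S: "\<gamma> r \<in> S" if "0 \<le> r" "r \<le> s" for r
      using that d'(2)[of r] S(2) s by (cases "r = 0") (auto simp: \<gamma>_def)
    obtain z where z: "0 < z" "z < s" "f (\<gamma> s) - f (\<gamma> 0) = (s - 0) * (h \<bullet> G (\<gamma> z))"
      using MVT2[of 0 s "\<lambda>s. f (\<gamma> s)" "\<lambda>s. h \<bullet> G (\<gamma> s)"] d1 in_S s by auto
    have "h \<bullet> G (\<gamma> z) > 0" using d(2)[of z] z s G0 by (simp add: \<gamma>_def)
    then have "f (\<gamma> s) > f (\<gamma> 0)" using z(3) s by (simp add: algebra_simps)
    then show False using max[OF in_S[of s]] s by (simp add: \<gamma>_def)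
  qed
qed

section \<open>Cutoffs and extension of twice differentiable functions\<close>

text \<open>An exponent of at least two makes the difference quotient at the kink tend to 0. The
  instances \<open>n = 1\<close> and \<open>n = 0\<close> give the first and second derivative of
  the cubed positive part.\<close>

lemma DERIV_max_0_power:
  "((\<lambda>y::real. (max 0 y) ^ Suc (Suc n)) has_real_derivative real (Suc (Suc n)) * (max 0 y) ^ Suc n) (at y)"
proof -
  consider "y < 0" | "y > 0" | "y = 0" by linarith
  then show ?thesis
  proof cases
    case 1
    have "((\<lambda>y::real. 0) has_real_derivative 0) (at y)" by simp
    then have "((\<lambda>y::real. (max 0 y) ^ Suc (Suc n)) has_real_derivative 0) (at y)"
      by (rule has_field_derivative_transform_within_open[where S="{..<0}"]) (use 1 in auto)
    then show ?thesis using 1 by simp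
  next
    case 2
    have "((\<lambda>y::real. y ^ Suc (Suc n)) has_real_derivative real (Suc (Suc n)) * y ^ Suc n) (at y)"
      by (rule DERIV_pow[THEN DERIV_cong]) simp
    then have "((\<lambda>y::real. (max 0 y) ^ Suc (Suc n)) has_real_derivative real (Suc (Suc n)) * y ^ Suc n) (at y)"
      by (rule has_field_derivative_transform_within_open[where S="{0<..}"]) (use 2 in auto)
    then show ?thesis using 2 by simp
  next
    case 3
    have "((\<lambda>h::real. (max 0 h) ^ Suc (Suc n) / h) \<longlongrightarrow> 0) (at 0)"
    proof (rule Lim_null_comparison)
      have "\<bar>(max 0 h) ^ Suc (Suc n) / h\<bar> = (max 0 h) ^ Suc n" for h :: real
        by (cases "h > 0") auto
      then show "\<forall>\<^sub>F h in at 0. norm ((max 0 h) ^ Suc (Suc n) / h) \<le> (max 0 h) ^ Suc n"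
        by (simp del: power_Suc)
      have "((\<lambda>h::real. (max 0 h) ^ Suc n) \<longlongrightarrow> (max 0 0) ^ Suc n) (at 0)"
        by (intro tendsto_intros)
      then show "((\<lambda>h::real. (max 0 h) ^ Suc n) \<longlongrightarrow> 0) (at 0)" by simp
    qed
    then show ?thesis using 3 by (simp add: DERIV_def)
  qed
qed

lemma C2_on_max_0_cube:
  assumes "C2_on S f"
  shows "C2_on S (\<lambda>x. (max 0 (f x)) ^ 3)"
proof -
  from assms obtain G H where f: "C2_jet S f G H" unfolding C2_on_iff_C2_jet by blast
  have 1: "((\<lambda>y::real. (max 0 y) ^ 3) has_real_derivative 3 * (max 0 y)\<^sup>2) (at y)" for y
    using DERIV_max_0_power[of 1] by (simp add: numeral_eq_Suc del: power_Suc)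
  have 2: "((\<lambda>y::real. 3 * (max 0 y)\<^sup>2) has_real_derivative 3 * (2 * max 0 y)) (at y)" for y
    using DERIV_cmult[OF DERIV_max_0_power[of 0], of 3] by (simp add: numeral_2_eq_2)
  have "continuous_on UNIV (\<lambda>y::real. 3 * (2 * max 0 y))" by (intro continuous_intros)
  from C2_jet_compose[OF f 1 2 this] show ?thesis unfolding C2_on_iff_C2_jet by blast
qed

lemma C2_on_diff_const:
  assumes "C2_on S f"
  shows "C2_on S (\<lambda>x. f x - c)" "C2_on S (\<lambda>x. c - f x)"
proof -
  from assms obtain G H where f: "C2_jet S f G H" unfolding C2_on_iff_C2_jet by blast
  have "C2_jet S (\<lambda>x. f x + - c) (\<lambda>x. G x + 0) (\<lambda>x h. H x h + 0)"
    by (intro C2_jet_add f C2_jet_const)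
  then show "C2_on S (\<lambda>x. f x - c)"
    unfolding C2_on_iff_C2_jet diff_conv_add_uminus by blast
  have "C2_jet S (\<lambda>x. c + (- 1) * f x) (\<lambda>x. 0 + ((- 1) *\<^sub>R G x + f x *\<^sub>R 0))
      (\<lambda>x h. 0 + ((- 1) *\<^sub>R H x h + (h \<bullet> 0) *\<^sub>R G x + (f x *\<^sub>R 0 + (h \<bullet> G x) *\<^sub>R 0)))"
    by (intro C2_jet_add C2_jet_mult f C2_jet_const)
  moreover have "(\<lambda>x. c + (- 1) * f x) = (\<lambda>x. c - f x)" by auto
  ultimately show "C2_on S (\<lambda>x. c - f x)"
    unfolding C2_on_iff_C2_jet by metis
qed

lemma C2_on_mult:
  assumes "C2_on S f" "C2_on S g"
  shows "C2_on S (\<lambda>x. f x * g x)"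
  using assms C2_jet_mult unfolding C2_on_iff_C2_jet by blast

text \<open>A supersolution on a larger set can be tested only with functions that are C^2 there;
  multiplying \<open>f\<close> by a cutoff gives one with the same germ at \<open>x\<close>. The
  product is C^2 on \<open>S\<close> and zero off a closed ball inside \<open>S\<close>, and these
  two open sets cover the space.\<close>

lemma C2_on_extension:
  assumes "C2_on S f" "open S" "x \<in> S"
  obtains g d where "C2_on UNIV g" "d > 0" "ball x d \<subseteq> S" "\<And>y. y \<in> ball x d \<Longrightarrow> g y = f y"
proof -
  obtain e where e: "e > 0" "cball x e \<subseteq> S"
    using assms open_contains_cball by blast
  define Q where "Q y = 2 / e\<^sup>2 * ((y - x) \<bullet> (y - x))" for y
  have Q: "Q y = 2 * (dist x y / e)\<^sup>2" for y
    by (simp add: Q_def dist_norm power2_norm_eq_inner[symmetric] norm_minus_commute power_divide)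
  text \<open>A \<open>C\<^sup>2\<close> cutoff, equal to 1 where \<open>Q \<le> 1\<close> and to 0 where \<open>Q \<ge> 2\<close>.\<close>
  define \<kappa> where "\<kappa> y = (max 0 (1 - (max 0 (Q y - 1)) ^ 3)) ^ 3" for y
  have "C2_on UNIV Q"
    unfolding Q_def C2_on_iff_C2_jet using C2_jet_mult[OF C2_jet_const C2_jet_dist_square] by blast
  then have \<kappa>: "C2_on UNIV \<kappa>"
    unfolding \<kappa>_def by (intro C2_on_max_0_cube C2_on_diff_const)
  define g where "g y = \<kappa> y * f y" for y
  have one: "\<kappa> y = 1" if "dist x y < e / 2" for y
  proof -
    have "dist x y / e \<le> 1/2" using that e by (simp add: field_simps)
    then have "(dist x y / e)\<^sup>2 \<le> (1/2)\<^sup>2" using e by (intro power_mono) auto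
    then have "Q y \<le> 1" unfolding Q power2_eq_square by linarith
    then show ?thesis by (simp add: \<kappa>_def max_def)
  qed
  have zero: "\<kappa> y = 0" if "dist x y > e" for y
  proof -
    have "dist x y / e \<ge> 1" using that e by (simp add: field_simps)
    then have "(dist x y / e)\<^sup>2 \<ge> 1" by (simp add: one_le_power)
    then have "Q y - 1 \<ge> 1" by (simp add: Q)
    then have "(max 0 (Q y - 1)) ^ 3 \<ge> 1" by (intro one_le_power) auto
    then show ?thesis by (simp add: \<kappa>_def)
  qed
  have "C2_jet (- cball x e) g (\<lambda>x. 0) (\<lambda>x h. 0)"
    by (rule C2_jet_cong[OF C2_jet_const[of _ 0]]) (auto simp: g_def zero)
  then have 1: "C2_on (- cball x e) g" unfolding C2_on_iff_C2_jet by blast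
  have "C2_on S \<kappa>" using \<kappa> C2_jet_subset unfolding C2_on_iff_C2_jet by blast
  then have "C2_on S g" unfolding g_def using assms by (intro C2_on_mult)
  from C2_on_Un[OF this 1] have "C2_on (S \<union> - cball x e) g" using assms by auto
  moreover have "S \<union> - cball x e = UNIV" using e by blast
  ultimately have "C2_on UNIV g" by simp
  moreover have "ball x (e/2) \<subseteq> S" using e by (auto simp: subset_iff)
  moreover have "g y = f y" if "y \<in> ball x (e/2)" for y using that by (simp add: g_def one)
  ultimately show ?thesis using that[of g "e/2"] e by simp
qed

section \<open>The spatial operator in a coordinate direction\<close>

text \<open>Each operator acts on a slice of \<phi> with one variable frozen; composing the
  space-time jet with the slice map expresses it through \<open>G\<close> and \<open>H\<close>. The
  last formula also uses the expansion of the divergence in \<open>Delta_pq_eq_F_pq\<close>.\<close>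

lemma C2_jet_operators:
  fixes \<phi> :: "(real ^ 'n) \<times> real \<Rightarrow> real"
  assumes \<phi>: "C2_jet S \<phi> G H" and S: "open S" "\<xi> \<in> S"
  shows "grad_x \<phi> \<xi> = fst (G \<xi>)" "dt \<phi> \<xi> = snd (G \<xi>)"
    "fst (G \<xi>) \<noteq> 0 \<Longrightarrow>
      Delta_pq_x p q \<phi> \<xi> = F_pq p q (fst (G \<xi>)) (matrix (\<lambda>h. fst (H \<xi> (h, 0))))"
proof -
  obtain x t where \<xi>: "\<xi> = (x, t)" by fastforce
  have pair_x: "((\<lambda>y. (y, t)) has_derivative (\<lambda>h. (h, 0))) (at y)" for y :: "real ^ 'n"
    by (auto intro!: derivative_eq_intros)
  have pair_t: "((\<lambda>s. (x, s)) has_derivative (\<lambda>h. (0, h))) (at s)" for s :: real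
    by (auto intro!: derivative_eq_intros)
  have x_slice: "((\<lambda>y. \<phi> (y, t)) has_derivative (\<lambda>h. h \<bullet> fst (G (y, t)))) (at y)"
    if "(y, t) \<in> S" for y
    using has_derivative_compose[OF pair_x, of \<phi>, OF C2_jetD(1)[OF \<phi> that]]
    by (simp add: inner_prod_def)
  have grad: "grad (\<lambda>y. \<phi> (y, t)) y = fst (G (y, t))" if "(y, t) \<in> S" for y
    unfolding grad_def frechet_derivative_at[OF x_slice[OF that], symmetric]
    by (simp add: inner_axis' vec_eq_iff)
  then show gx: "grad_x \<phi> \<xi> = fst (G \<xi>)" using S by (simp add: grad_x_def \<xi>)
  have "((\<lambda>s. \<phi> (x, s)) has_derivative (\<lambda>h. h * snd (G \<xi>))) (at t)"
    using has_derivative_compose[OF pair_t, of \<phi>, OF C2_jetD(1)[OF \<phi> S(2)[unfolded \<xi>]]]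
    by (simp add: inner_prod_def \<xi>)
  then have "((\<lambda>s. \<phi> (x, s)) has_real_derivative snd (G \<xi>)) (at t)"
    by (rule has_derivative_imp_has_field_derivative) simp
  then show "dt \<phi> \<xi> = snd (G \<xi>)" by (simp add: dt_def \<xi> DERIV_imp_deriv)
  \<comment> \<open>The gradient of the slice is known only where the slice runs inside
    \<open>S\<close>; to differentiate it at \<open>x\<close>, this set must be a neighbourhood of
    \<open>x\<close>.\<close>
  let ?T = "(\<lambda>y. (y, t)) -` S"
  have T: "open ?T" "x \<in> ?T"
    using S by (auto simp: \<xi> intro!: open_vimage continuous_intros)
  have "((\<lambda>y. G (y, t)) has_derivative (\<lambda>h. H \<xi> (h, 0))) (at x)"
    using has_derivative_compose[OF pair_x, of G, OF C2_jetD(2)[OF \<phi> S(2)[unfolded \<xi>]]]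
    by (simp add: \<xi>)
  then have "((\<lambda>y. fst (G (y, t))) has_derivative (\<lambda>h. fst (H \<xi> (h, 0)))) (at x)"
    by (rule has_derivative_fst)
  then have D: "(grad (\<lambda>y. \<phi> (y, t)) has_derivative (\<lambda>h. fst (H \<xi> (h, 0)))) (at x)"
    by (rule has_derivative_transform_within_open[OF _ T]) (simp add: grad)
  have h: "hess (\<lambda>y. \<phi> (y, t)) x = matrix (\<lambda>h. fst (H \<xi> (h, 0)))"
    by (simp add: hess_def jacobian_def frechet_derivative_at[OF D, symmetric])
  assume "fst (G \<xi>) \<noteq> 0"
  then have "Delta_pq p q (\<lambda>y. \<phi> (y, t)) x = F_pq p q (grad (\<lambda>y. \<phi> (y, t)) x) (hess (\<lambda>y. \<phi> (y, t)) x)"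
    using gx D by (intro Delta_pq_eq_F_pq) (auto simp: grad_x_def \<xi> differentiable_def)
  then show "Delta_pq_x p q \<phi> \<xi> = F_pq p q (fst (G \<xi>)) (matrix (\<lambda>h. fst (H \<xi> (h, 0))))"
    using gx h by (simp add: Delta_pq_x_def \<xi> grad_x_def)
qed

text \<open>For \<eta> along the i-th axis the normalized outer product is the projection onto that
  axis, so the operator sees only the diagonal of \<open>X\<close>. This is the reason for working
  with functions of one space coordinate: at a local maximum each diagonal entry is controlled by
  \<open>C2_jet_local_max\<close>.\<close>

lemma F_pq_axis:
  fixes X :: "real ^ 'n ^ 'n"
  assumes "c \<noteq> 0"
  shows "F_pq p q (c *\<^sub>R axis i 1) X = \<bar>c\<bar> powr (q - 2) * (trace X + (p - 2) * X $ i $ i)"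
proof -
  have "trace (X + (p - 2) *\<^sub>R (((1 / (norm (c *\<^sub>R axis i 1 :: real ^ 'n))\<^sup>2) *\<^sub>R
      outer (c *\<^sub>R axis i 1) (c *\<^sub>R axis i 1)) ** X))
      = trace X + (p - 2) * (\<Sum>k\<in>UNIV. \<Sum>l\<in>UNIV. axis i 1 $ k * axis i 1 $ l * X $ l $ k)"
    using assms by (simp add: trace_def outer_def matrix_matrix_mult_def sum.distrib sum_distrib_left
        power2_eq_square field_simps sum_subtractf)
  also have "(\<Sum>k\<in>UNIV. \<Sum>l\<in>UNIV. axis i (1::real) $ k * axis i 1 $ l * X $ l $ k)
      = (\<Sum>k\<in>UNIV. if k = i then X $ i $ i else 0)"
  proof (rule sum.cong)
    fix k
    have "(\<Sum>l\<in>UNIV. axis i (1::real) $ k * axis i 1 $ l * X $ l $ k)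
        = (\<Sum>l\<in>UNIV. if l = i then (if k = i then X $ i $ i else 0) else 0)"
      by (intro sum.cong) (auto simp: axis_def)
    then show "(\<Sum>l\<in>UNIV. axis i (1::real) $ k * axis i 1 $ l * X $ l $ k)
        = (if k = i then X $ i $ i else 0)" by simp
  qed simp
  finally show ?thesis by (simp add: F_pq_def)
qed

lemma C2_jet_Delta_axis:
  fixes \<phi> :: "(real ^ 'n) \<times> real \<Rightarrow> real"
  assumes \<phi>: "C2_jet S \<phi> G H" and S: "open S" "\<xi> \<in> S"
    and c: "fst (G \<xi>) = c *\<^sub>R axis i 1" "c \<noteq> 0"
  shows "Delta_pq_x p q \<phi> \<xi> = \<bar>c\<bar> powr (q - 2) *
    ((\<Sum>k\<in>UNIV. H \<xi> (axis k 1, 0) \<bullet> (axis k 1, 0)) + (p - 2) * (H \<xi> (axis i 1, 0) \<bullet> (axis i 1, 0)))"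
proof -
  have "matrix (\<lambda>h. fst (H \<xi> (h, 0))) $ k $ k = H \<xi> (axis k 1, 0) \<bullet> (axis k 1, 0)" for k :: 'n
    by (simp add: matrix_def inner_prod_def inner_axis)
  moreover have "fst (G \<xi>) \<noteq> 0" using c by (simp add: axis_eq_0_iff)
  ultimately show ?thesis
    using C2_jet_operators(3)[OF \<phi> S, of p q] c by (simp add: F_pq_axis trace_def)
qed

section \<open>Restricting and pasting supersolutions\<close>

text \<open>Admissibility depends only on the germ at \<xi>, because the cylinder may be
  shrunk.\<close>

lemma admissible_at_local:
  assumes "admissible_at p q \<Theta> \<phi> \<xi>" and d: "d > 0" "ball \<xi> d \<subseteq> \<Theta>'"
    and eq: "\<And>\<eta>. \<eta> \<in> ball \<xi> d \<Longrightarrow> \<psi> \<eta> = \<phi> \<eta>"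
    and "grad_x \<psi> \<xi> = grad_x \<phi> \<xi>" "dt \<psi> \<xi> = dt \<phi> \<xi>"
  shows "admissible_at p q \<Theta>' \<psi> \<xi>"
proof (cases "grad_x \<phi> \<xi> = 0")
  case False
  then show ?thesis using assms by (simp add: admissible_at_def)
next
  case True
  then obtain \<delta> f \<sigma> where \<delta>: "\<delta> > 0" and fs: "f \<in> radial_class (F_pq p q :: real ^ 'a \<Rightarrow> real ^ 'a ^ 'a \<Rightarrow> real)"
      "\<sigma> \<in> Sigma_class"
    and bound: "\<And>x t. x \<in> ball (fst \<xi>) \<delta> \<Longrightarrow> t \<in> {snd \<xi> - \<delta> <..< snd \<xi> + \<delta>} \<Longrightarrow>
          \<bar>\<phi> (x, t) - \<phi> \<xi> - dt \<phi> \<xi> * (t - snd \<xi>)\<bar> \<le> f (norm (x - fst \<xi>)) + \<sigma> (t - snd \<xi>)"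
    using assms(1) unfolding admissible_at_def by blast
  \<comment> \<open>The distance in space-time is at most the sum of the distances in space and in
    time, so a cylinder of size \<open>d / 2\<close> fits into the ball of radius
    \<open>d\<close>.\<close>
  define \<delta>' where "\<delta>' = min \<delta> (d / 2)"
  have \<delta>': "\<delta>' > 0" "\<delta>' \<le> \<delta>" "\<delta>' \<le> d / 2" using \<delta> d by (auto simp: \<delta>'_def)
  have cyl: "(x, t) \<in> ball \<xi> d" if "x \<in> ball (fst \<xi>) \<delta>'" "t \<in> {snd \<xi> - \<delta>' <..< snd \<xi> + \<delta>'}" for x t
  proof -
    have "dist \<xi> (x, t) \<le> dist (fst \<xi>) x + dist (snd \<xi>) t"
      using sqrt_sum_squares_le_sum[of "dist (fst \<xi>) x" "dist (snd \<xi>) t"] by (simp add: dist_prod_def)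
    moreover have "dist (snd \<xi>) t < \<delta>'" using that by (auto simp: dist_real_def)
    moreover have "dist (fst \<xi>) x < \<delta>'" using that by auto
    ultimately show ?thesis using \<delta>' by simp
  qed
  have "ball (fst \<xi>) \<delta>' \<times> {snd \<xi> - \<delta>' <..< snd \<xi> + \<delta>'} \<subseteq> \<Theta>'"
    using cyl d by auto
  moreover have "\<bar>\<psi> (x, t) - \<psi> \<xi> - dt \<psi> \<xi> * (t - snd \<xi>)\<bar> \<le> f (norm (x - fst \<xi>)) + \<sigma> (t - snd \<xi>)"
    if "x \<in> ball (fst \<xi>) \<delta>'" "t \<in> {snd \<xi> - \<delta>' <..< snd \<xi> + \<delta>'}" for x t
    using bound[of x t] that \<delta>' eq[OF cyl[OF that]] eq[of \<xi>] d assms(6) by auto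
  ultimately show ?thesis
    unfolding admissible_at_def using \<delta>'(1) fs by blast
qed

lemma viscosity_supersolutionD:
  assumes "viscosity_supersolution p q \<Theta> u" "\<xi> \<in> \<Theta>"
  shows "u \<xi> \<noteq> - \<infinity>" "u \<xi> \<le> Liminf (at \<xi> within \<Theta>) u"
    and "C2_on \<Theta> \<phi> \<Longrightarrow> admissible_at p q \<Theta> \<phi> \<xi> \<Longrightarrow> touches_from_below \<Theta> \<phi> u \<xi> \<Longrightarrow>
      (if grad_x \<phi> \<xi> \<noteq> 0 then dt \<phi> \<xi> - Delta_pq_x p q \<phi> \<xi> \<ge> 0 else dt \<phi> \<xi> \<ge> 0)"
  using assms unfolding viscosity_supersolution_def by blast+

text \<open>A test function is only \<open>C\<^sup>2\<close> on the smaller set, so it is first cut off.\<close>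

lemma viscosity_supersolution_subset:
  assumes u: "viscosity_supersolution p q \<Theta> u"
    and o: "open \<Theta>" "open \<Theta>'" and sub: "\<Theta>' \<subseteq> \<Theta>"
  shows "viscosity_supersolution p q \<Theta>' u"
proof -
  have at: "at \<xi> within \<Theta>' = at \<xi>" "at \<xi> within \<Theta> = at \<xi>" if "\<xi> \<in> \<Theta>'" for \<xi>
    using at_within_open[OF that o(2)] at_within_open[OF subsetD[OF sub that] o(1)] .
  have "\<Theta>' \<subseteq> \<Theta>' \<inter> closure {\<xi> \<in> \<Theta>. u \<xi> \<noteq> \<infinity>}"
    using u sub by (auto simp: viscosity_supersolution_def)
  also have "\<dots> \<subseteq> closure (\<Theta>' \<inter> {\<xi> \<in> \<Theta>. u \<xi> \<noteq> \<infinity>})"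
    using o by (intro open_Int_closure_subset)
  also have "\<dots> \<subseteq> closure {\<xi> \<in> \<Theta>'. u \<xi> \<noteq> \<infinity>}" by (intro closure_mono) auto
  finally have dense: "\<Theta>' \<subseteq> closure {\<xi> \<in> \<Theta>'. u \<xi> \<noteq> \<infinity>}" .
  have test: "if grad_x \<phi> \<xi> \<noteq> 0 then dt \<phi> \<xi> - Delta_pq_x p q \<phi> \<xi> \<ge> 0 else dt \<phi> \<xi> \<ge> 0"
    if \<xi>: "\<xi> \<in> \<Theta>'" and \<phi>: "C2_on \<Theta>' \<phi>" "admissible_at p q \<Theta>' \<phi> \<xi>" "touches_from_below \<Theta>' \<phi> u \<xi>" for \<phi> \<xi>
  proof -
    obtain \<psi> d where \<psi>: "C2_on UNIV \<psi>" and d: "d > 0" "ball \<xi> d \<subseteq> \<Theta>'"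
      and eq: "\<And>\<eta>. \<eta> \<in> ball \<xi> d \<Longrightarrow> \<psi> \<eta> = \<phi> \<eta>"
      using C2_on_extension[OF \<phi>(1) o(2) \<xi>] by blast
    obtain G H where "C2_jet \<Theta>' \<phi> G H" using \<phi>(1) unfolding C2_on_iff_C2_jet by blast
    then have J: "C2_jet (ball \<xi> d) \<phi> G H" using d C2_jet_subset by blast
    \<comment> \<open>Near \<xi> both functions have the same jet, so the inequality obtained by
      testing with \<psi> is the one wanted for \<phi>.\<close>
    then have J': "C2_jet (ball \<xi> d) \<psi> G H" by (rule C2_jet_cong) (use eq in auto)
    have \<xi>_ball: "\<xi> \<in> ball \<xi> d" using d by simp
    note ops = C2_jet_operators[OF J open_ball \<xi>_ball] C2_jet_operators[OF J' open_ball \<xi>_ball]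
    have "C2_on \<Theta> \<psi>" using \<psi> C2_jet_subset unfolding C2_on_iff_C2_jet by blast
    moreover have "admissible_at p q \<Theta> \<psi> \<xi>"
      by (rule admissible_at_local[OF \<phi>(2) d(1)]) (use d sub eq ops in auto)
    moreover have "touches_from_below \<Theta> \<psi> u \<xi>"
    proof -
      have "\<forall>\<^sub>F \<eta> in at \<xi>. \<eta> \<in> ball \<xi> d" using d by (intro eventually_at_in_open') auto
      moreover have "\<forall>\<^sub>F \<eta> in at \<xi>. ereal (\<phi> \<eta>) < u \<eta>"
        using \<phi>(3) at[OF \<xi>] by (simp add: touches_from_below_def)
      ultimately have "\<forall>\<^sub>F \<eta> in at \<xi>. ereal (\<psi> \<eta>) < u \<eta>"
        by eventually_elim (simp add: eq)
      then show ?thesis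
        using \<phi>(3) at[OF \<xi>] eq[OF \<xi>_ball] by (simp add: touches_from_below_def)
    qed
    ultimately have "if grad_x \<psi> \<xi> \<noteq> 0 then dt \<psi> \<xi> - Delta_pq_x p q \<psi> \<xi> \<ge> 0 else dt \<psi> \<xi> \<ge> 0"
      using viscosity_supersolutionD(3)[OF u] \<xi> sub by blast
    then show ?thesis using ops by (cases "fst (G \<xi>) = 0") auto
  qed
  have "u \<xi> \<noteq> - \<infinity>" "u \<xi> \<le> Liminf (at \<xi> within \<Theta>') u" if "\<xi> \<in> \<Theta>'" for \<xi>
    using viscosity_supersolutionD(1,2)[OF u, of \<xi>] that sub at[OF that] by auto
  then show ?thesis
    using dense test unfolding viscosity_supersolution_def by blast
qed

text \<open>In \<open>N\<close> this is the minimum of two supersolutions. On the collar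
  \<open>N - K\<close> the minimum is already \<open>w\<close>, so within \<Theta> the pasted
  function equals \<open>w\<close> off \<open>K\<close> and no seam arises at the boundary of
  \<open>N\<close>.\<close>

lemma viscosity_supersolution_paste:
  assumes \<Theta>: "open \<Theta>" "open N" and K: "closed K" "K \<subseteq> N"
    and u: "viscosity_supersolution p q (\<Theta> \<inter> N) u"
    and w: "viscosity_supersolution p q \<Theta> (\<lambda>\<eta>. ereal (w \<eta>))"
    and le: "\<And>\<eta>. \<eta> \<in> \<Theta> \<inter> N - K \<Longrightarrow> ereal (w \<eta>) \<le> u \<eta>"
  shows "viscosity_supersolution p q \<Theta> (\<lambda>\<eta>. if \<eta> \<in> N then min (u \<eta>) (ereal (w \<eta>)) else ereal (w \<eta>))"
    (is "viscosity_supersolution p q \<Theta> ?v")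
proof -
  have oN: "open (\<Theta> \<inter> N)" using \<Theta> by auto
  have at: "at \<xi> within \<Theta> \<inter> N = at \<xi>" if "\<xi> \<in> \<Theta> \<inter> N" for \<xi>
    using at_within_open[OF that oN] .
  have at': "at \<xi> within \<Theta> = at \<xi>" if "\<xi> \<in> \<Theta>" for \<xi>
    using at_within_open[OF that \<Theta>(1)] .
  have v_le: "?v \<eta> \<le> ereal (w \<eta>)" for \<eta> by auto
  have fin: "?v \<eta> \<noteq> \<infinity>" for \<eta> by (auto simp: min_def)
  have lsc: "?v \<xi> \<le> Liminf (at \<xi> within \<Theta>) ?v" if \<xi>: "\<xi> \<in> \<Theta>" for \<xi>
  proof (unfold le_Liminf_iff, intro allI impI)
    fix y assume y: "y < ?v \<xi>"
    have "y < ereal (w \<xi>)" using y v_le by (rule less_le_trans)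
    then have w': "\<forall>\<^sub>F \<eta> in at \<xi>. y < ereal (w \<eta>)"
      using viscosity_supersolutionD(2)[OF w \<xi>] at'[OF \<xi>] by (simp add: le_Liminf_iff)
    show "\<forall>\<^sub>F \<eta> in at \<xi> within \<Theta>. y < ?v \<eta>"
    proof (cases "\<xi> \<in> N")
      case True
      then have "\<forall>\<^sub>F \<eta> in at \<xi>. y < u \<eta>"
        using viscosity_supersolutionD(2)[OF u, of \<xi>] y \<xi> at[of \<xi>] by (simp add: le_Liminf_iff)
      with w' show ?thesis unfolding at'[OF \<xi>] by eventually_elim auto
    next
      \<comment> \<open>A point outside \<open>N\<close> has a neighbourhood off \<open>K\<close>,
        where the pasted function is \<open>w\<close>.\<close>
      case False
      then have "\<forall>\<^sub>F \<eta> in at \<xi>. \<eta> \<in> \<Theta> - K"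
        using K \<Theta> \<xi> by (intro eventually_at_in_open') auto
      with w' show ?thesis unfolding at'[OF \<xi>]
      proof eventually_elim
        case (elim \<eta>)
        then show ?case using le[of \<eta>] by auto
      qed
    qed
  qed
  have test: "if grad_x \<phi> \<xi> \<noteq> 0 then dt \<phi> \<xi> - Delta_pq_x p q \<phi> \<xi> \<ge> 0 else dt \<phi> \<xi> \<ge> 0"
    if \<xi>: "\<xi> \<in> \<Theta>" and \<phi>: "C2_on \<Theta> \<phi>" "admissible_at p q \<Theta> \<phi> \<xi>" "touches_from_below \<Theta> \<phi> ?v \<xi>" for \<phi> \<xi>
  \<comment> \<open>A test function touching the minimum from below also touches from below
    whichever of \<open>u\<close> and \<open>w\<close> attains the minimum at \<xi>.\<close>
  proof (cases "\<xi> \<in> N \<and> u \<xi> \<le> ereal (w \<xi>)")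
    case True
    then have \<xi>N: "\<xi> \<in> \<Theta> \<inter> N" using \<xi> by simp
    have "C2_on (\<Theta> \<inter> N) \<phi>"
      using \<phi>(1) C2_jet_subset[OF _ Int_lower1] unfolding C2_on_iff_C2_jet by blast
    moreover obtain d where "d > 0" "ball \<xi> d \<subseteq> \<Theta> \<inter> N"
      using oN \<xi>N open_contains_ball by blast
    with \<phi>(2) have "admissible_at p q (\<Theta> \<inter> N) \<phi> \<xi>"
      by (rule admissible_at_local) auto
    moreover have "touches_from_below (\<Theta> \<inter> N) \<phi> u \<xi>"
    proof -
      have "\<forall>\<^sub>F \<eta> in at \<xi>. \<eta> \<in> N" using \<xi>N \<Theta> by (intro eventually_at_in_open') auto
      moreover have "\<forall>\<^sub>F \<eta> in at \<xi>. ereal (\<phi> \<eta>) < ?v \<eta>"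
        using \<phi>(3) at'[OF \<xi>] by (simp add: touches_from_below_def)
      ultimately have "\<forall>\<^sub>F \<eta> in at \<xi>. ereal (\<phi> \<eta>) < u \<eta>" by eventually_elim auto
      then show ?thesis
        using \<phi>(3) True at[OF \<xi>N] by (simp add: touches_from_below_def min_absorb1)
    qed
    ultimately show ?thesis using viscosity_supersolutionD(3)[OF u \<xi>N] by blast
  next
    case False
    then have "?v \<xi> = ereal (w \<xi>)" by (auto simp: min_def)
    moreover have "\<forall>\<^sub>F \<eta> in at \<xi> within \<Theta>. ereal (\<phi> \<eta>) < ereal (w \<eta>)"
    proof -
      have "\<forall>\<^sub>F \<eta> in at \<xi> within \<Theta>. ereal (\<phi> \<eta>) < ?v \<eta>"
        using \<phi>(3) unfolding touches_from_below_def by blast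
      then show ?thesis by (rule eventually_mono) (erule less_le_trans[OF _ v_le])
    qed
    ultimately have "touches_from_below \<Theta> \<phi> (\<lambda>\<eta>. ereal (w \<eta>)) \<xi>"
      using \<phi>(3) by (simp add: touches_from_below_def)
    then show ?thesis using viscosity_supersolutionD(3)[OF w \<xi>] \<phi> by blast
  qed
  have "?v \<xi> \<noteq> - \<infinity>" if "\<xi> \<in> \<Theta>" for \<xi>
    using viscosity_supersolutionD(1)[OF u, of \<xi>] that by (auto simp: min_def)
  moreover have "{\<xi> \<in> \<Theta>. ?v \<xi> \<noteq> \<infinity>} = \<Theta>" using fin by blast
  then have "\<Theta> \<subseteq> closure {\<xi> \<in> \<Theta>. ?v \<xi> \<noteq> \<infinity>}" by (simp only: closure_subset)
  ultimately show ?thesis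
    using lsc test unfolding viscosity_supersolution_def by blast
qed

lemma le_Liminf_of_continuous:
  assumes "isCont g \<xi>" "\<forall>\<^sub>F \<eta> in at \<xi> within S. ereal (g \<eta>) \<le> u \<eta>"
  shows "ereal (g \<xi>) \<le> Liminf (at \<xi> within S) u"
proof (unfold le_Liminf_iff, intro allI impI)
  fix y assume y: "y < ereal (g \<xi>)"
  have "(g \<longlongrightarrow> g \<xi>) (at \<xi> within S)" using assms(1) by (simp add: continuous_at_imp_continuous_at_within continuous_within[symmetric])
  then have "((\<lambda>\<eta>. ereal (g \<eta>)) \<longlongrightarrow> ereal (g \<xi>)) (at \<xi> within S)" by (intro tendsto_intros)
  from order_tendstoD(1)[OF this y] assms(2) show "\<forall>\<^sub>F \<eta> in at \<xi> within S. y < u \<eta>"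
    by eventually_elim (rule less_le_trans)
qed

text \<open>For a continuous real \<open>w\<close>, semicontinuity and density are automatic, which
  leaves the test inequality. Contact is rephrased as \<phi> \<le> \<open>w\<close> on an open set
  carrying a jet of \<phi>, the form in which \<open>C2_jet_local_max\<close> applies.\<close>

lemma viscosity_supersolution_continuousI:
  assumes \<Theta>: "open \<Theta>" and w: "continuous_on UNIV w"
    and test: "\<And>\<phi> \<xi> S G H. \<xi> \<in> S \<Longrightarrow> S \<subseteq> \<Theta> \<Longrightarrow> open S \<Longrightarrow> C2_jet S \<phi> G H \<Longrightarrow> \<phi> \<xi> = w \<xi> \<Longrightarrow>
      (\<And>\<eta>. \<eta> \<in> S \<Longrightarrow> \<phi> \<eta> \<le> w \<eta>) \<Longrightarrow>
      (if grad_x \<phi> \<xi> \<noteq> 0 then dt \<phi> \<xi> - Delta_pq_x p q \<phi> \<xi> \<ge> 0 else dt \<phi> \<xi> \<ge> 0)"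
  shows "viscosity_supersolution p q \<Theta> (\<lambda>\<eta>. ereal (w \<eta>))"
proof -
  have "if grad_x \<phi> \<xi> \<noteq> 0 then dt \<phi> \<xi> - Delta_pq_x p q \<phi> \<xi> \<ge> 0 else dt \<phi> \<xi> \<ge> 0"
    if \<xi>: "\<xi> \<in> \<Theta>" and \<phi>: "C2_on \<Theta> \<phi>" "touches_from_below \<Theta> \<phi> (\<lambda>\<eta>. ereal (w \<eta>)) \<xi>" for \<phi> \<xi>
  proof -
    have at: "at \<xi> within \<Theta> = at \<xi>" using at_within_open[OF \<xi> \<Theta>] .
    have eq: "\<phi> \<xi> = w \<xi>" and "\<forall>\<^sub>F \<eta> in at \<xi>. \<phi> \<eta> < w \<eta>"
      using \<phi>(2) at by (auto simp: touches_from_below_def)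
    then obtain N where N: "open N" "\<xi> \<in> N" "\<And>\<eta>. \<eta> \<in> N \<Longrightarrow> \<eta> \<noteq> \<xi> \<Longrightarrow> \<phi> \<eta> < w \<eta>"
      unfolding eventually_at_topological by auto
    obtain G H where "C2_jet \<Theta> \<phi> G H" using \<phi>(1) unfolding C2_on_iff_C2_jet by blast
    then have J: "C2_jet (\<Theta> \<inter> N) \<phi> G H" by (rule C2_jet_subset) simp
    have "\<phi> \<eta> \<le> w \<eta>" if "\<eta> \<in> \<Theta> \<inter> N" for \<eta>
      using that N(3)[of \<eta>] eq by (cases "\<eta> = \<xi>") auto
    with J show ?thesis using \<xi> N \<Theta> eq by (intro test[of \<xi> "\<Theta> \<inter> N"]) auto
  qed
  moreover have "ereal (w \<xi>) \<le> Liminf (at \<xi> within \<Theta>) (\<lambda>\<eta>. ereal (w \<eta>))" for \<xi>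
    using w by (intro le_Liminf_of_continuous) (simp_all add: continuous_on_eq_continuous_at del: split_paired_All)
  moreover have "\<Theta> \<subseteq> closure {\<xi> \<in> \<Theta>. ereal (w \<xi>) \<noteq> \<infinity>}"
    by (simp add: closure_subset)
  moreover have "ereal (w \<xi>) \<noteq> - \<infinity>" for \<xi> by simp
  ultimately show ?thesis unfolding viscosity_supersolution_def by blast
qed

lemma viscosity_supersolution_const:
  assumes "open \<Theta>"
  shows "viscosity_supersolution p q \<Theta> (\<lambda>\<eta>. ereal M)"
proof (rule viscosity_supersolution_continuousI[OF assms, where w="\<lambda>_. M"])
  fix \<phi> :: "(real ^ 'a) \<times> real \<Rightarrow> real" and \<xi> S G H
  assume *: "\<xi> \<in> S" "open S" "C2_jet S \<phi> G H" "\<phi> \<xi> = M" "\<And>\<eta>. \<eta> \<in> S \<Longrightarrow> \<phi> \<eta> \<le> M"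
  have "G \<xi> = 0" by (rule C2_jet_local_max(1)[OF *(3,2,1)]) (use * in auto)
  then show "if grad_x \<phi> \<xi> \<noteq> 0 then dt \<phi> \<xi> - Delta_pq_x p q \<phi> \<xi> \<ge> 0 else dt \<phi> \<xi> \<ge> 0"
    using C2_jet_operators(1,2)[OF *(3,2,1)] by simp
qed auto

section \<open>Ramps and bowls\<close>

text \<open>With s = A exp(\<sigma> (x - x_0)_i) and \<sigma> of absolute value 1, the spatial
  gradient is \<sigma> s times the i-th unit vector and the only nonzero second derivative in x is
  s. The exponential thus keeps slope and convexity positive in size by the same amount.\<close>

definition ramp :: "real \<Rightarrow> real \<Rightarrow> (real ^ 'n) \<times> real \<Rightarrow> 'n \<Rightarrow> real \<Rightarrow> (real ^ 'n) \<times> real \<Rightarrow> real" where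
  "ramp A b \<zeta> i \<sigma> \<eta> = A * (exp (\<sigma> * (fst \<eta> - fst \<zeta>) $ i) - 1) + b * (snd \<eta> - snd \<zeta>)"

text \<open>The maximum norm in x makes this a maximum of finitely many ramps, one for each
  coordinate, sign in space and sign in time.\<close>

definition bowl :: "real \<Rightarrow> real \<Rightarrow> (real ^ 'n) \<times> real \<Rightarrow> (real ^ 'n) \<times> real \<Rightarrow> real" where
  "bowl A B \<zeta> \<eta> = A * (exp (infnorm (fst \<eta> - fst \<zeta>)) - 1) + B * \<bar>snd \<eta> - snd \<zeta>\<bar>"

text \<open>Under this condition every ramp is a strict subsolution, and every negative ramp a strict
  supersolution: the spatial operator maps \<open>ramp A b \<zeta> i \<sigma>\<close> to \<open>(p - 1) s powr (q - 1)\<close> with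
  \<open>s = A exp (\<sigma> (x - x\<^sub>0)\<^sub>i)\<close>.\<close>

definition steep :: "real \<Rightarrow> real \<Rightarrow> ((real ^ 'n) \<times> real) set \<Rightarrow> (real ^ 'n) \<times> real \<Rightarrow> real \<Rightarrow> real \<Rightarrow> bool" where
  "steep p q \<Theta> \<zeta> A B \<longleftrightarrow> A > 0 \<and> B \<ge> 0 \<and>
     (\<forall>\<eta>\<in>\<Theta>. B < (p - 1) * (A * exp (- norm (fst \<eta> - fst \<zeta>))) powr (q - 1))"

lemma steep_subset: "steep p q \<Theta> \<zeta> A B \<Longrightarrow> \<Theta>' \<subseteq> \<Theta> \<Longrightarrow> steep p q \<Theta>' \<zeta> A B"
  by (auto simp: steep_def)

lemma bowl_self [simp]: "bowl A B \<zeta> \<zeta> = 0"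
  by (simp add: bowl_def infnorm_0)

lemma continuous_on_bowl: "continuous_on S (bowl A B \<zeta>)"
  unfolding bowl_def by (intro continuous_intros)

lemma bowl_nonneg: "A \<ge> 0 \<Longrightarrow> B \<ge> 0 \<Longrightarrow> bowl A B \<zeta> \<eta> \<ge> 0"
  by (simp add: bowl_def infnorm_pos_le)

lemma ramp_le_bowl:
  assumes "A \<ge> 0" "\<bar>\<sigma>\<bar> = 1" "\<bar>b\<bar> \<le> B"
  shows "ramp A b \<zeta> i \<sigma> \<eta> \<le> bowl A B \<zeta> \<eta>"
proof -
  have "\<sigma> * (fst \<eta> - fst \<zeta>) $ i \<le> \<bar>\<sigma> * (fst \<eta> - fst \<zeta>) $ i\<bar>" by simp
  also have "\<dots> \<le> infnorm (fst \<eta> - fst \<zeta>)"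
    using component_le_infnorm_cart[of "fst \<eta> - fst \<zeta>" i] assms(2) by (simp add: abs_mult)
  finally have "A * (exp (\<sigma> * (fst \<eta> - fst \<zeta>) $ i) - 1) \<le> A * (exp (infnorm (fst \<eta> - fst \<zeta>)) - 1)"
    using assms(1) by (intro mult_left_mono) auto
  moreover have "b * (snd \<eta> - snd \<zeta>) \<le> B * \<bar>snd \<eta> - snd \<zeta>\<bar>"
  proof -
    have "b * (snd \<eta> - snd \<zeta>) \<le> \<bar>b\<bar> * \<bar>snd \<eta> - snd \<zeta>\<bar>" by (simp flip: abs_mult)
    also have "\<dots> \<le> B * \<bar>snd \<eta> - snd \<zeta>\<bar>" using assms(3) by (intro mult_right_mono) auto
    finally show ?thesis .
  qed
  ultimately show ?thesis unfolding ramp_def bowl_def by (rule add_mono)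
qed

text \<open>The maximum is attained: \<open>i\<close> is a coordinate of largest absolute value, and
  the signs are those of that coordinate and of the time difference. Together with
  \<open>ramp_le_bowl\<close> this exhibits the bowl as a pointwise maximum.\<close>

lemma bowl_eq_ramp:
  obtains i \<sigma> b where "\<bar>\<sigma>\<bar> = 1" "\<bar>b\<bar> = \<bar>B\<bar>" "bowl A B \<zeta> \<eta> = ramp A b \<zeta> i \<sigma> \<eta>"
proof -
  let ?x = "fst \<eta> - fst \<zeta>"
  let ?\<sigma> = "\<lambda>r::real. if r \<ge> 0 then 1 else - 1"
  have "infnorm ?x \<in> (\<lambda>e. \<bar>?x \<bullet> e\<bar>) ` Basis"
    unfolding infnorm_Max by (intro Max_in) auto
  then obtain i where "infnorm ?x = \<bar>?x $ i\<bar>"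
    by (auto simp: Basis_vec_def inner_axis)
  then have "infnorm ?x = ?\<sigma> (?x $ i) * ?x $ i" by simp
  moreover have "B * \<bar>snd \<eta> - snd \<zeta>\<bar> = (?\<sigma> (snd \<eta> - snd \<zeta>) * B) * (snd \<eta> - snd \<zeta>)" by simp
  ultimately have "bowl A B \<zeta> \<eta> = ramp A (?\<sigma> (snd \<eta> - snd \<zeta>) * B) \<zeta> i (?\<sigma> (?x $ i)) \<eta>"
    unfolding bowl_def ramp_def by simp
  then show ?thesis by (rule that[rotated 2]) auto
qed

lemma C2_jet_ramp:
  fixes \<zeta> :: "(real ^ 'n) \<times> real"
  assumes "\<bar>\<sigma>\<bar> = 1"
  shows "C2_jet S (ramp A b \<zeta> i \<sigma>)
    (\<lambda>\<eta>. ((\<sigma> * (A * exp (\<sigma> * (fst \<eta> - fst \<zeta>) $ i))) *\<^sub>R axis i 1, b))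
    (\<lambda>\<eta> h. ((A * exp (\<sigma> * (fst \<eta> - fst \<zeta>) $ i) * fst h $ i) *\<^sub>R axis i 1, 0))"
proof -
  \<comment> \<open>Differentiating twice in x brings out the square of \<sigma>, so the second
    derivative is positive for either sign when \<open>A\<close> is.\<close>
  have \<sigma>: "\<sigma> * \<sigma> = 1" using assms by (metis abs_mult_self_eq mult_1)
  let ?a = "(axis i 1, 0) :: (real ^ 'n) \<times> real"
  let ?E = "\<lambda>\<eta>. A * exp (\<sigma> * (\<eta> \<bullet> ?a + - (\<zeta> \<bullet> ?a)))"
  have E: "?E \<eta> = A * exp (\<sigma> * (fst \<eta> - fst \<zeta>) $ i)" for \<eta>
    by (simp add: inner_prod_def inner_axis)
  have "C2_jet S (\<lambda>\<eta>. \<eta> \<bullet> ?a + - (\<zeta> \<bullet> ?a)) (\<lambda>\<eta>. ?a + 0) (\<lambda>\<eta> h. 0 + 0)"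
    by (intro C2_jet_add C2_jet_inner C2_jet_const)
  then have "C2_jet S (\<lambda>\<eta>. A * exp (\<sigma> * (\<eta> \<bullet> ?a + - (\<zeta> \<bullet> ?a)))) (\<lambda>\<eta>. (A * (\<sigma> * exp (\<sigma> * (\<eta> \<bullet> ?a + - (\<zeta> \<bullet> ?a))))) *\<^sub>R (?a + 0))
      (\<lambda>\<eta> h. (A * (\<sigma> * exp (\<sigma> * (\<eta> \<bullet> ?a + - (\<zeta> \<bullet> ?a))))) *\<^sub>R (0 + 0) +
        ((A * (\<sigma> * (\<sigma> * exp (\<sigma> * (\<eta> \<bullet> ?a + - (\<zeta> \<bullet> ?a)))))) * (h \<bullet> (?a + 0))) *\<^sub>R (?a + 0))"
    by (rule C2_jet_compose[where g="\<lambda>y. A * exp (\<sigma> * y)" and g'="\<lambda>y. A * (\<sigma> * exp (\<sigma> * y))"])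
      (auto intro!: derivative_eq_intros continuous_intros)
  moreover have "C2_jet S (\<lambda>\<eta>. \<eta> \<bullet> (0, b) + (- A - b * snd \<zeta>)) (\<lambda>\<eta>. (0, b) + 0) (\<lambda>\<eta> h. 0 + 0)"
    by (intro C2_jet_add C2_jet_inner C2_jet_const)
  ultimately have "C2_jet S (\<lambda>\<eta>. A * exp (\<sigma> * (\<eta> \<bullet> ?a + - (\<zeta> \<bullet> ?a))) + (\<eta> \<bullet> (0, b) + (- A - b * snd \<zeta>)))
    (\<lambda>\<eta>. (A * (\<sigma> * exp (\<sigma> * (\<eta> \<bullet> ?a + - (\<zeta> \<bullet> ?a))))) *\<^sub>R (?a + 0) + ((0, b) + 0))
    (\<lambda>\<eta> h. (A * (\<sigma> * exp (\<sigma> * (\<eta> \<bullet> ?a + - (\<zeta> \<bullet> ?a))))) *\<^sub>R (0 + 0) +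
        ((A * (\<sigma> * (\<sigma> * exp (\<sigma> * (\<eta> \<bullet> ?a + - (\<zeta> \<bullet> ?a)))))) * (h \<bullet> (?a + 0))) *\<^sub>R (?a + 0) + (0 + 0))"
    by (rule C2_jet_add)
  moreover have "(\<lambda>\<eta>. A * exp (\<sigma> * (\<eta> \<bullet> ?a + - (\<zeta> \<bullet> ?a))) + (\<eta> \<bullet> (0, b) + (- A - b * snd \<zeta>))) = ramp A b \<zeta> i \<sigma>"
    by (auto simp: ramp_def inner_prod_def inner_axis algebra_simps fun_eq_iff)
  moreover have "(\<lambda>\<eta>. (A * (\<sigma> * exp (\<sigma> * (\<eta> \<bullet> ?a + - (\<zeta> \<bullet> ?a))))) *\<^sub>R (?a + 0) + ((0, b) + 0))
    = (\<lambda>\<eta>. ((\<sigma> * (A * exp (\<sigma> * (fst \<eta> - fst \<zeta>) $ i))) *\<^sub>R axis i 1, b))"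
    by (auto simp: inner_prod_def inner_axis fun_eq_iff)
  moreover have "(\<lambda>\<eta> h. (A * (\<sigma> * exp (\<sigma> * (\<eta> \<bullet> ?a + - (\<zeta> \<bullet> ?a))))) *\<^sub>R (0 + 0) +
        ((A * (\<sigma> * (\<sigma> * exp (\<sigma> * (\<eta> \<bullet> ?a + - (\<zeta> \<bullet> ?a)))))) * (h \<bullet> (?a + 0))) *\<^sub>R (?a + 0) + (0 + 0))
    = (\<lambda>\<eta> h. ((A * exp (\<sigma> * (fst \<eta> - fst \<zeta>) $ i) * fst h $ i) *\<^sub>R axis i 1, 0))"
    using \<sigma> by (auto simp: inner_prod_def inner_axis fun_eq_iff mult.assoc[symmetric])
  ultimately show ?thesis by simp
qed

text \<open>The exponent of every ramp is at least minus the Euclidean norm, and the power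
  \<open>q - 1\<close> is positive, so the single bound in \<open>steep\<close> serves all
  coordinates and both signs.\<close>

lemma steep_ramp:
  assumes "steep p q \<Theta> \<zeta> A B" "p > 1" "q > 1" "\<bar>\<sigma>\<bar> = 1" "\<eta> \<in> \<Theta>"
  shows "B < (p - 1) * (A * exp (\<sigma> * (fst \<eta> - fst \<zeta>) $ i)) powr (q - 1)"
proof -
  have "\<bar>\<sigma> * (fst \<eta> - fst \<zeta>) $ i\<bar> \<le> norm (fst \<eta> - fst \<zeta>)"
    using component_le_norm_cart[of "fst \<eta> - fst \<zeta>" i] assms(4) by (simp add: abs_mult)
  then have "A * exp (- norm (fst \<eta> - fst \<zeta>)) \<le> A * exp (\<sigma> * (fst \<eta> - fst \<zeta>) $ i)"
    using assms(1) by (intro mult_left_mono) (auto simp: steep_def)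
  then have "(p - 1) * (A * exp (- norm (fst \<eta> - fst \<zeta>))) powr (q - 1)
      \<le> (p - 1) * (A * exp (\<sigma> * (fst \<eta> - fst \<zeta>) $ i)) powr (q - 1)"
    using assms by (intro mult_left_mono powr_mono2) (auto simp: steep_def)
  moreover have "B < (p - 1) * (A * exp (- norm (fst \<eta> - fst \<zeta>))) powr (q - 1)"
    using assms(1,5) unfolding steep_def by blast
  ultimately show ?thesis by linarith
qed

lemma axis_nth_if: "axis k (1::real) $ i = (if k = i then 1 else 0)"
  by (simp add: axis_def)

text \<open>In direction \<open>i\<close> the coefficients 1 and \<open>p - 2\<close> add up to
  \<open>p - 1 > 0\<close>, and in the other directions the coefficient is 1; hence upper bounds on
  the diagonal second derivatives bound the operator. The inequality is for test functions below a
  negative ramp, the equality for a ramp itself.\<close>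

lemma C2_jet_Delta_signed_axis:
  fixes \<phi> :: "(real ^ 'n) \<times> real \<Rightarrow> real"
  assumes \<phi>: "C2_jet S \<phi> G H" and S: "open S" "\<xi> \<in> S"
    and c: "fst (G \<xi>) = (\<sigma> * s) *\<^sub>R axis i 1" "\<bar>\<sigma>\<bar> = 1" "s > 0" and p: "p > 1"
  shows "(\<And>k. H \<xi> (axis k 1, 0) \<bullet> (axis k 1, 0) \<le> (if k = i then \<tau> else 0)) \<Longrightarrow>
      Delta_pq_x p q \<phi> \<xi> \<le> s powr (q - 2) * ((p - 1) * \<tau>)"
    and "(\<And>k. H \<xi> (axis k 1, 0) \<bullet> (axis k 1, 0) = (if k = i then \<tau> else 0)) \<Longrightarrow>
      Delta_pq_x p q \<phi> \<xi> = s powr (q - 2) * ((p - 1) * \<tau>)"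
proof -
  define h where "h k = H \<xi> (axis k 1, 0) \<bullet> (axis k 1, 0)" for k
  have eq: "Delta_pq_x p q \<phi> \<xi> = s powr (q - 2) * ((\<Sum>k\<in>UNIV - {i}. h k) + (p - 1) * h i)"
  proof -
    have "\<sigma> * s \<noteq> 0" "\<bar>\<sigma> * s\<bar> = s" using c by (auto simp: abs_mult)
    moreover have "(\<Sum>k\<in>UNIV. h k) = h i + (\<Sum>k\<in>UNIV - {i}. h k)" by (rule sum.remove) auto
    ultimately show ?thesis
      using C2_jet_Delta_axis[OF \<phi> S c(1), of p q] by (simp add: h_def algebra_simps)
  qed
  show "Delta_pq_x p q \<phi> \<xi> \<le> s powr (q - 2) * ((p - 1) * \<tau>)" if "\<And>k. h k \<le> (if k = i then \<tau> else 0)"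
  proof -
    have "(\<Sum>k\<in>UNIV - {i}. h k) \<le> 0" using that by (intro sum_nonpos) (metis DiffD2 singletonI)
    moreover have "(p - 1) * h i \<le> (p - 1) * \<tau>" using that[of i] p by (intro mult_left_mono) auto
    ultimately show ?thesis unfolding eq by (intro mult_left_mono) auto
  qed
  show "Delta_pq_x p q \<phi> \<xi> = s powr (q - 2) * ((p - 1) * \<tau>)" if "\<And>k. h k = (if k = i then \<tau> else 0)"
    unfolding eq using that by simp
qed

lemma powr_diff_1_conv: "s > 0 \<Longrightarrow> s powr (q - 2) * (a * s) = a * s powr (q - 1)" for s :: real
  using powr_add[of s "q - 2" 1] by simp

text \<open>The function is a minimum of negative ramps, so a test function from below is compared
  with one ramp active at the contact point. There it has the gradient of minus that ramp and no
  larger second derivatives along the axes; its operator is therefore less than \<open>- B\<close>,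
  while its time derivative is at least \<open>- B\<close>.\<close>

lemma viscosity_supersolution_bowl:
  assumes pq: "p > 1" "q > 1" and \<Theta>: "open \<Theta>" and st: "steep p q \<Theta> \<zeta> A B"
  shows "viscosity_supersolution p q \<Theta> (\<lambda>\<eta>. ereal (c - bowl A B \<zeta> \<eta>))"
proof (rule viscosity_supersolution_continuousI[OF \<Theta>])
  show "continuous_on UNIV (\<lambda>\<eta>. c - bowl A B \<zeta> \<eta>)"
    by (intro continuous_intros continuous_on_bowl)
next
  fix \<phi> :: "(real ^ 'a) \<times> real \<Rightarrow> real" and \<xi> S G H
  assume S: "\<xi> \<in> S" "S \<subseteq> \<Theta>" "open S" and J: "C2_jet S \<phi> G H" and eq: "\<phi> \<xi> = c - bowl A B \<zeta> \<xi>"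
    and le: "\<And>\<eta>. \<eta> \<in> S \<Longrightarrow> \<phi> \<eta> \<le> c - bowl A B \<zeta> \<eta>"
  have AB: "A > 0" "B \<ge> 0" using st by (auto simp: steep_def)
  obtain i \<sigma> b where \<sigma>: "\<bar>\<sigma>\<bar> = 1" and b: "\<bar>b\<bar> = \<bar>B\<bar>" and r: "bowl A B \<zeta> \<xi> = ramp A b \<zeta> i \<sigma> \<xi>"
    by (rule bowl_eq_ramp)
  define s where "s = A * exp (\<sigma> * (fst \<xi> - fst \<zeta>) $ i)"
  have s: "s > 0" using AB by (simp add: s_def)
  note J' = C2_jet_add[OF J C2_jet_ramp[OF \<sigma>, of S A b \<zeta> i]]
  have "\<phi> \<eta> + ramp A b \<zeta> i \<sigma> \<eta> \<le> \<phi> \<xi> + ramp A b \<zeta> i \<sigma> \<xi>" if "\<eta> \<in> S" for \<eta>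
    using le[OF that] ramp_le_bowl[of A \<sigma> b B \<zeta> i \<eta>] AB \<sigma> b eq r by simp
  note max = C2_jet_local_max[OF J' S(3,1) this]
  have G: "fst (G \<xi>) = ((- \<sigma>) * s) *\<^sub>R axis i 1" "snd (G \<xi>) = - b"
  proof -
    have "fst (G \<xi>) + (\<sigma> * s) *\<^sub>R axis i 1 = 0" "snd (G \<xi>) + b = 0"
      using max(1) by (simp_all add: s_def prod_eq_iff)
    then show "fst (G \<xi>) = ((- \<sigma>) * s) *\<^sub>R axis i 1" "snd (G \<xi>) = - b"
      by (simp_all add: eq_neg_iff_add_eq_0)
  qed
  have H: "H \<xi> (axis k 1, 0) \<bullet> (axis k 1, 0) \<le> (if k = i then - s else 0)" for k
    using max(2)[of "(axis k 1, 0)"]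
    by (auto simp: inner_add_left s_def inner_prod_def inner_axis_axis axis_nth_if split: if_splits)
  have "Delta_pq_x p q \<phi> \<xi> \<le> s powr (q - 2) * ((p - 1) * (- s))"
    using \<sigma> s pq by (intro C2_jet_Delta_signed_axis(1)[OF J S(3,1) G(1)] H) auto
  also have "\<dots> = - ((p - 1) * s powr (q - 1))"
    using powr_diff_1_conv[OF s, of q "p - 1"] by simp
  also have "\<dots> < - B"
    using steep_ramp[OF st pq \<sigma>, of \<xi> i] S by (auto simp: s_def)
  finally have "Delta_pq_x p q \<phi> \<xi> \<le> - b" using b AB by auto
  moreover have "grad_x \<phi> \<xi> = ((- \<sigma>) * s) *\<^sub>R axis i 1" "dt \<phi> \<xi> = - b"
    using C2_jet_operators(1,2)[OF J S(3,1)] G by auto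
  ultimately show "if grad_x \<phi> \<xi> \<noteq> 0 then dt \<phi> \<xi> - Delta_pq_x p q \<phi> \<xi> \<ge> 0 else dt \<phi> \<xi> \<ge> 0"
    using \<sigma> s by (auto simp: axis_eq_0_iff)
qed

section \<open>Comparison of supersolutions with ramps, bowls and constants\<close>

text \<open>The negative minimum of \<open>u - v\<close> is attained inside: a minimizing sequence
  has a limit point in the closure, which the boundary bound keeps off the frontier and at which
  semicontinuity gives the value. As \<open>u\<close> may be infinite, subtraction is avoided and
  \<open>k\<close> is taken as the largest constant with \<open>v + k\<close> \<le>
  \<open>u\<close>.\<close>

lemma lsc_negative_minimum:
  fixes u :: "'a::euclidean_space \<Rightarrow> ereal" and v :: "'a \<Rightarrow> real"
  assumes \<Theta>: "open \<Theta>" "bounded \<Theta>" and v: "continuous_on UNIV v"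
    and u: "\<And>\<eta>. \<eta> \<in> \<Theta> \<Longrightarrow> ereal m \<le> u \<eta>" "\<And>\<eta>. \<eta> \<in> \<Theta> \<Longrightarrow> u \<eta> \<le> Liminf (at \<eta> within \<Theta>) u"
    and bd: "\<And>\<eta>. \<eta> \<in> frontier \<Theta> \<Longrightarrow> ereal (v \<eta>) \<le> Liminf (at \<eta> within \<Theta>) u"
    and neg: "\<eta>\<^sub>0 \<in> \<Theta>" "u \<eta>\<^sub>0 < ereal (v \<eta>\<^sub>0)"
  obtains \<xi> k where "\<xi> \<in> \<Theta>" "u \<xi> = ereal (v \<xi> + k)" "\<And>\<eta>. \<eta> \<in> \<Theta> \<Longrightarrow> ereal (v \<eta> + k) \<le> u \<eta>"
proof -
  have lower: "\<forall>\<^sub>F \<eta> in at l within \<Theta>. ereal (v \<eta> + y) < u \<eta>"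
    if lt: "ereal (v l + y) < Liminf (at l within \<Theta>) u" for l y
  proof -
    obtain z where z: "ereal (v l + y) < ereal z" "ereal z < Liminf (at l within \<Theta>) u"
      using ereal_dense2[OF lt] by auto
    have "\<forall>\<^sub>F \<eta> in at l within \<Theta>. ereal z < u \<eta>"
      using z(2) le_Liminf_iff[of "Liminf (at l within \<Theta>) u" "at l within \<Theta>" u] by blast
    moreover have "(v \<longlongrightarrow> v l) (at l within \<Theta>)"
      using v by (metis UNIV_I continuous_on_def subset_UNIV tendsto_within_subset)
    then have "\<forall>\<^sub>F \<eta> in at l within \<Theta>. v \<eta> < z - y"
      by (rule order_tendstoD) (use z in auto)
    ultimately show ?thesis
    proof eventually_elim
      case (elim \<eta>)
      then have "ereal (v \<eta> + y) < ereal z" by simp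
      from less_trans[OF this elim(1)] show ?case .
    qed
  qed
  define Y where "Y = {y. \<forall>\<eta>\<in>\<Theta>. ereal (v \<eta> + y) \<le> u \<eta>}"
  define k where "k = Sup Y"
  obtain r where r: "\<And>\<eta>. \<eta> \<in> \<Theta> \<Longrightarrow> \<bar>v \<eta>\<bar> \<le> r"
  proof -
    have "bounded (v ` closure \<Theta>)"
      using \<Theta> v by (intro compact_imp_bounded compact_continuous_image)
        (auto simp: compact_closure intro: continuous_on_subset)
    then show ?thesis using that closure_subset by (force simp: bounded_iff)
  qed
  have "m - r \<in> Y"
    unfolding Y_def
  proof (intro CollectI ballI)
    fix \<eta> assume "\<eta> \<in> \<Theta>"
    then have "ereal (v \<eta> + (m - r)) \<le> ereal m" using r[of \<eta>] by auto
    also have "\<dots> \<le> u \<eta>" using u \<open>\<eta> \<in> \<Theta>\<close> by blast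
    finally show "ereal (v \<eta> + (m - r)) \<le> u \<eta>" .
  qed
  then have ne: "Y \<noteq> {}" by auto
  obtain z0 where z0: "u \<eta>\<^sub>0 < ereal z0" "ereal z0 < ereal (v \<eta>\<^sub>0)"
    using ereal_dense2[OF neg(2)] by auto
  have Y_le: "y \<le> z0 - v \<eta>\<^sub>0" if "y \<in> Y" for y
  proof -
    have "ereal (v \<eta>\<^sub>0 + y) \<le> u \<eta>\<^sub>0" using that neg by (auto simp: Y_def)
    then have "ereal (v \<eta>\<^sub>0 + y) < ereal z0" using z0(1) by (rule le_less_trans)
    then show ?thesis by simp
  qed
  then have bdd: "bdd_above Y" by (auto intro!: bdd_aboveI)
  have "k \<le> z0 - v \<eta>\<^sub>0" unfolding k_def using ne Y_le by (rule cSup_least)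
  then have k_neg: "k < 0" using z0 by simp
  have kY: "ereal (v \<eta> + k) \<le> u \<eta>" if \<eta>: "\<eta> \<in> \<Theta>" for \<eta>
  proof (rule ereal_le_real, rule ccontr)
    fix z :: real
    assume z: "u \<eta> \<le> ereal z" and "\<not> ereal (v \<eta> + k) \<le> ereal z"
    then have "z - v \<eta> < k" by simp
    then obtain y where "y \<in> Y" "z - v \<eta> < y" unfolding k_def using ne less_cSupE by blast
    then have "ereal (v \<eta> + y) \<le> u \<eta>" using \<eta> by (simp add: Y_def)
    then have "ereal (v \<eta> + y) \<le> ereal z" using z by (rule order_trans)
    with \<open>z - v \<eta> < y\<close> show False by simp
  qed
  have "\<exists>\<eta>\<in>\<Theta>. u \<eta> < ereal (v \<eta> + (k + inverse (Suc n)))" for n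
  proof (rule ccontr)
    assume "\<not> ?thesis"
    then have "k + inverse (Suc n) \<in> Y" by (auto simp: Y_def not_less)
    then have "k + inverse (Suc n) \<le> k" unfolding k_def by (rule cSup_upper[OF _ bdd])
    then show False by simp
  qed
  then obtain X where X: "\<And>n. X n \<in> \<Theta>" "\<And>n. u (X n) < ereal (v (X n) + (k + inverse (Suc n)))"
    by metis
  have "X n \<in> closure \<Theta>" for n using X closure_subset by blast
  then obtain l \<rho> where l: "l \<in> closure \<Theta>" "strict_mono \<rho>" "(X \<circ> \<rho>) \<longlonglongrightarrow> l"
    using \<Theta>(2) compact_closure[of \<Theta>] unfolding compact_def by meson
  \<comment> \<open>A strict bound \<open>v + y < u\<close> around \<open>l\<close> with
    \<open>k < y\<close> contradicts the minimizing sequence. It is used twice: with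
    \<open>y = k / 2\<close>, between \<open>k\<close> and 0, to exclude a frontier limit, and with
    \<open>y = z - v l\<close> to exclude that \<open>u l\<close> exceeds
    \<open>v l + k\<close>.\<close>
  have near: False if y: "k < y" and N: "\<forall>\<^sub>F \<eta> in nhds l. \<eta> \<in> \<Theta> \<longrightarrow> ereal (v \<eta> + y) < u \<eta>" for y
  proof -
    have "(\<lambda>n. k + inverse (Suc n)) \<longlonglongrightarrow> k + 0"
      by (intro tendsto_add tendsto_const LIMSEQ_inverse_real_of_nat)
    then have "(\<lambda>n. k + inverse (Suc (\<rho> n))) \<longlonglongrightarrow> k"
      using LIMSEQ_subseq_LIMSEQ[OF _ l(2)] by (fastforce simp: o_def)
    then have "\<forall>\<^sub>F n in sequentially. k + inverse (Suc (\<rho> n)) < y" using y by (rule order_tendstoD)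
    moreover have "\<forall>\<^sub>F n in sequentially. (X \<circ> \<rho>) n \<in> \<Theta> \<longrightarrow> ereal (v ((X \<circ> \<rho>) n) + y) < u ((X \<circ> \<rho>) n)"
      using eventually_compose_filterlim[OF N l(3)] .
    ultimately have "\<forall>\<^sub>F n in sequentially. False"
    proof eventually_elim
      case (elim n)
      have "ereal (v (X (\<rho> n)) + y) < ereal (v (X (\<rho> n)) + (k + inverse (Suc (\<rho> n))))"
        using elim(2) X(1)[of "\<rho> n"] by (intro less_trans[OF _ X(2)]) simp
      then show ?case using elim(1) by simp
    qed
    then show False by simp
  qed
  have "l \<in> \<Theta>"
  proof (rule ccontr)
    assume "l \<notin> \<Theta>"
    then have "l \<in> frontier \<Theta>" using l \<Theta> by (simp add: frontier_def interior_open)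
    from bd[OF this] have "ereal (v l + k / 2) < Liminf (at l within \<Theta>) u"
      using k_neg by (intro less_le_trans[OF _ bd[OF \<open>l \<in> frontier \<Theta>\<close>]]) simp
    from lower[OF this] have "\<forall>\<^sub>F \<eta> in nhds l. \<eta> \<in> \<Theta> \<longrightarrow> ereal (v \<eta> + k / 2) < u \<eta>"
      unfolding eventually_at_filter using \<open>l \<notin> \<Theta>\<close> by (auto elim: eventually_mono)
    then show False using near[of "k / 2"] k_neg by simp
  qed
  moreover have "u l \<le> ereal (v l + k)"
  proof (rule ccontr)
    assume "\<not> ?thesis"
    then have "ereal (v l + k) < u l" by simp
    from ereal_dense2[OF this] obtain z where z: "v l + k < z" "ereal z < u l" by auto
    then have lt: "ereal (v l + (z - v l)) < u l" by simp
    from lower[OF less_le_trans[OF this u(2)[OF \<open>l \<in> \<Theta>\<close>]]]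
    have "\<forall>\<^sub>F \<eta> in nhds l. \<eta> \<in> \<Theta> \<longrightarrow> ereal (v \<eta> + (z - v l)) < u \<eta>"
      unfolding eventually_at_filter
    proof (rule eventually_mono)
      fix \<eta> assume "\<eta> \<noteq> l \<longrightarrow> \<eta> \<in> \<Theta> \<longrightarrow> ereal (v \<eta> + (z - v l)) < u \<eta>"
      then show "\<eta> \<in> \<Theta> \<longrightarrow> ereal (v \<eta> + (z - v l)) < u \<eta>" using lt by (cases "\<eta> = l") auto
    qed
    then show False using near[of "z - v l"] z by simp
  qed
  then have "u l = ereal (v l + k)" using kY[OF \<open>l \<in> \<Theta>\<close>] by (rule antisym)
  ultimately show ?thesis using that kY by blast
qed

text \<open>A ramp is a smooth strict subsolution with nonvanishing spatial gradient. If it exceeded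
  \<open>u\<close> somewhere, a vertical translate would meet \<open>u\<close> from below at an
  interior point; made strict, it is an admissible test function that violates the supersolution
  inequality.\<close>

lemma viscosity_supersolution_ge_ramp:
  assumes pq: "p > 1" "q > 1" and \<Theta>: "open \<Theta>" "bounded \<Theta>"
    and u: "viscosity_supersolution p q \<Theta> u" "\<And>\<eta>. \<eta> \<in> \<Theta> \<Longrightarrow> ereal m \<le> u \<eta>"
    and st: "steep p q \<Theta> \<zeta> A B" and \<sigma>: "\<bar>\<sigma>\<bar> = 1" and b: "b \<le> B"
    and bd: "\<And>\<xi>. \<xi> \<in> frontier \<Theta> \<Longrightarrow> ereal (c + ramp A b \<zeta> i \<sigma> \<xi>) \<le> Liminf (at \<xi> within \<Theta>) u"
    and \<eta>: "\<eta> \<in> \<Theta>"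
  shows "ereal (c + ramp A b \<zeta> i \<sigma> \<eta>) \<le> u \<eta>"
proof (rule ccontr)
  assume "\<not> ?thesis"
  then have neg: "u \<eta> < ereal (c + ramp A b \<zeta> i \<sigma> \<eta>)" by simp
  let ?v = "\<lambda>\<eta>. c + ramp A b \<zeta> i \<sigma> \<eta>"
  have "continuous_on UNIV ?v"
    by (intro continuous_intros C2_jet_continuous(1)[OF C2_jet_ramp[OF \<sigma>]])
  from lsc_negative_minimum[OF \<Theta> this u(2) viscosity_supersolutionD(2)[OF u(1)] bd \<eta> neg]
  obtain \<xi> k where \<xi>: "\<xi> \<in> \<Theta>" "u \<xi> = ereal (?v \<xi> + k)"
    and min: "\<And>\<eta>. \<eta> \<in> \<Theta> \<Longrightarrow> ereal (?v \<eta> + k) \<le> u \<eta>" by auto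
  define s where "s = A * exp (\<sigma> * (fst \<xi> - fst \<zeta>) $ i)"
  have s: "s > 0" using st by (simp add: s_def steep_def)
  let ?Q = "\<lambda>\<eta>. (\<eta> - \<xi>) \<bullet> (\<eta> - \<xi>)"
  text \<open>The quartic makes the contact strict without changing derivatives up to second order at \<open>\<xi>\<close>.\<close>
  define \<phi> where "\<phi> \<eta> = ramp A b \<zeta> i \<sigma> \<eta> + ((c + k) + (- 1) * (?Q \<eta> * ?Q \<eta>))" for \<eta>
  note J = C2_jet_add[OF C2_jet_ramp[OF \<sigma>, of \<Theta> A b \<zeta> i]
      C2_jet_add[OF C2_jet_const[of \<Theta> "c + k"]
        C2_jet_mult[OF C2_jet_const[of \<Theta> "- 1"]
          C2_jet_mult[OF C2_jet_dist_square[of \<Theta> \<xi>] C2_jet_dist_square[of \<Theta> \<xi>]]]],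
      folded \<phi>_def]
  have "C2_on \<Theta> \<phi>" using J unfolding C2_on_iff_C2_jet by blast
  have grad: "grad_x \<phi> \<xi> = (\<sigma> * s) *\<^sub>R axis i 1" and dt: "dt \<phi> \<xi> = b"
    using C2_jet_operators(1,2)[OF J \<Theta>(1) \<xi>(1)] by (simp_all add: s_def)
  then have nz: "grad_x \<phi> \<xi> \<noteq> 0" using s \<sigma> by (auto simp: axis_eq_0_iff)
  have "Delta_pq_x p q \<phi> \<xi> = s powr (q - 2) * ((p - 1) * s)"
    using \<sigma> s pq
    by (intro C2_jet_Delta_signed_axis(2)[OF J \<Theta>(1) \<xi>(1), where \<sigma>=\<sigma> and i=i])
      (auto simp: s_def inner_prod_def inner_axis_axis axis_nth_if)
  also have "\<dots> = (p - 1) * s powr (q - 1)" by (rule powr_diff_1_conv[OF s])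
  also have "\<dots> > b" using steep_ramp[OF st pq \<sigma> \<xi>(1), of i] b by (simp add: s_def)
  finally have Delta: "b < Delta_pq_x p q \<phi> \<xi>" .
  have "touches_from_below \<Theta> \<phi> u \<xi>"
    unfolding touches_from_below_def
  proof
    show "ereal (\<phi> \<xi>) = u \<xi>" using \<xi> by (simp add: \<phi>_def)
    have "ereal (\<phi> \<eta>) < u \<eta>" if "\<eta> \<in> \<Theta>" "\<eta> \<noteq> \<xi>" for \<eta>
    proof -
      have "?Q \<eta> > 0" using that by simp
      then have "ereal (\<phi> \<eta>) < ereal (?v \<eta> + k)" by (simp add: \<phi>_def)
      then show ?thesis using min[OF that(1)] by (rule less_le_trans)
    qed
    then show "\<forall>\<^sub>F \<eta> in at \<xi> within \<Theta>. ereal (\<phi> \<eta>) < u \<eta>"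
      by (auto simp: eventually_at_filter)
  qed
  moreover have "admissible_at p q \<Theta> \<phi> \<xi>" using nz by (simp add: admissible_at_def)
  ultimately have "dt \<phi> \<xi> - Delta_pq_x p q \<phi> \<xi> \<ge> 0"
    using viscosity_supersolutionD(3)[OF u(1) \<xi>(1) \<open>C2_on \<Theta> \<phi>\<close>] nz by simp
  then show False using dt Delta by simp
qed

text \<open>For a fixed \<eta> one ramp suffices: a ramp active at \<eta> equals the bowl there and
  lies below it on the frontier.\<close>

lemma viscosity_supersolution_ge_bowl:
  assumes pq: "p > 1" "q > 1" and \<Theta>: "open \<Theta>" "bounded \<Theta>"
    and u: "viscosity_supersolution p q \<Theta> u" "\<And>\<eta>. \<eta> \<in> \<Theta> \<Longrightarrow> ereal m \<le> u \<eta>"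
    and st: "steep p q \<Theta> \<zeta> A B"
    and bd: "\<And>\<xi>. \<xi> \<in> frontier \<Theta> \<Longrightarrow> ereal (c + bowl A B \<zeta> \<xi>) \<le> Liminf (at \<xi> within \<Theta>) u"
    and \<eta>: "\<eta> \<in> \<Theta>"
  shows "ereal (c + bowl A B \<zeta> \<eta>) \<le> u \<eta>"
proof -
  have AB: "A > 0" "B \<ge> 0" using st by (auto simp: steep_def)
  obtain i \<sigma> b where \<sigma>: "\<bar>\<sigma>\<bar> = 1" and b: "\<bar>b\<bar> = \<bar>B\<bar>" and r: "bowl A B \<zeta> \<eta> = ramp A b \<zeta> i \<sigma> \<eta>"
    by (rule bowl_eq_ramp)
  have "ereal (c + ramp A b \<zeta> i \<sigma> \<xi>) \<le> Liminf (at \<xi> within \<Theta>) u" if "\<xi> \<in> frontier \<Theta>" for \<xi>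
    using ramp_le_bowl[of A \<sigma> b B \<zeta> i \<xi>] AB \<sigma> b by (intro order_trans[OF _ bd[OF that]]) simp
  from viscosity_supersolution_ge_ramp[OF pq \<Theta> u st \<sigma> _ this \<eta>] show ?thesis
    using b AB r by simp
qed

text \<open>A constant has zero gradient and is not a strict subsolution, so a shallow bowl centred
  at \<eta> takes its place: it adds at most \<open>e\<close> on the frontier and vanishes at
  \<eta>, the only point where the bound is wanted.\<close>

lemma viscosity_supersolution_ge_const:
  assumes pq: "p > 1" "q > 1" and \<Theta>: "open \<Theta>" "bounded \<Theta>"
    and u: "viscosity_supersolution p q \<Theta> u" "\<And>\<eta>. \<eta> \<in> \<Theta> \<Longrightarrow> ereal m \<le> u \<eta>"
    and bd: "\<And>\<xi>. \<xi> \<in> frontier \<Theta> \<Longrightarrow> ereal c \<le> Liminf (at \<xi> within \<Theta>) u"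
    and \<eta>: "\<eta> \<in> \<Theta>"
  shows "ereal c \<le> u \<eta>"
proof (rule ereal_le_epsilon2)
  fix e :: real assume e: "e > 0"
  obtain R where R: "\<And>\<xi>. \<xi> \<in> closure \<Theta> \<Longrightarrow> norm (\<xi> - \<eta>) \<le> R"
  proof -
    obtain R0 where "\<And>\<xi>. \<xi> \<in> closure \<Theta> \<Longrightarrow> norm \<xi> \<le> R0"
      using bounded_closure[OF \<Theta>(2)] by (auto simp: bounded_iff)
    then have "norm (\<xi> - \<eta>) \<le> R0 + norm \<eta>" if "\<xi> \<in> closure \<Theta>" for \<xi>
      using norm_triangle_ineq4[of \<xi> \<eta>] that by fastforce
    then show ?thesis using that by blast
  qed
  \<comment> \<open>Chosen so that \<open>A * exp R = e\<close>, which keeps the bowl below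
    \<open>e\<close> on the frontier.\<close>
  define A where "A = e * exp (- R)"
  have A: "A > 0" using e by (simp add: A_def)
  \<comment> \<open>With time slope 0 every positive \<open>A\<close> is steep.\<close>
  have st: "steep p q \<Theta> \<eta> A 0" using A pq by (auto simp: steep_def)
  have "ereal (c - e + bowl A 0 \<eta> \<xi>) \<le> Liminf (at \<xi> within \<Theta>) u" if \<xi>: "\<xi> \<in> frontier \<Theta>" for \<xi>
  proof -
    have "infnorm (fst \<xi> - fst \<eta>) \<le> norm (fst (\<xi> - \<eta>))" using infnorm_le_norm[of "fst (\<xi> - \<eta>)"] by simp
    also have "\<dots> \<le> norm (\<xi> - \<eta>)" by (metis norm_fst_le prod.collapse)
    also have "\<dots> \<le> R" using R \<xi> by (simp add: frontier_def)
    finally have "A * exp (infnorm (fst \<xi> - fst \<eta>)) \<le> A * exp R" using A by simp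
    also have "A * exp R = e" by (simp add: A_def exp_minus)
    finally have "c - e + bowl A 0 \<eta> \<xi> \<le> c" using A by (simp add: bowl_def algebra_simps)
    then show ?thesis by (intro order_trans[OF _ bd[OF \<xi>]]) simp
  qed
  from viscosity_supersolution_ge_bowl[OF pq \<Theta> u st this \<eta>]
  have "ereal (c - e) \<le> u \<eta>" by simp
  then have "ereal (c - e) + ereal e \<le> u \<eta> + ereal e" by (rule add_right_mono)
  then show "ereal c \<le> u \<eta> + ereal e" by simp
qed

section \<open>Localization of regularity\<close>

text \<open>\<open>B\<close> is fixed first, to make the bowl large in time; then \<open>A\<close>
  is taken large enough for the spatial directions and for steepness relative to \<open>B\<close>.
  This is possible because \<open>A\<close> enters with the positive power \<open>q - 1\<close> and
  the exponential factor is bounded below on a bounded set.\<close>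

lemma exists_steep_bowl:
  fixes \<Theta> :: "((real ^ 'n) \<times> real) set" and M :: real
  assumes pq: "p > 1" "q > 1" and \<Theta>: "bounded \<Theta>" and \<delta>: "\<delta> > 0"
  obtains A B where "steep p q \<Theta> \<zeta> A B" "\<And>\<eta>. dist \<eta> \<zeta> \<ge> \<delta> \<Longrightarrow> bowl A B \<zeta> \<eta> \<ge> M"
proof -
  obtain D where D: "\<And>\<eta>. \<eta> \<in> \<Theta> \<Longrightarrow> norm (fst \<eta> - fst \<zeta>) \<le> D"
  proof -
    obtain D where "\<And>\<eta>. \<eta> \<in> \<Theta> \<Longrightarrow> dist \<zeta> \<eta> \<le> D"
      using \<Theta> bounded_any_center[of \<Theta> \<zeta>] by auto
    moreover have "norm (fst \<eta> - fst \<zeta>) \<le> dist \<zeta> \<eta>" for \<eta> :: "(real ^ 'n) \<times> real"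
      using dist_fst_le[of \<eta> \<zeta>] by (simp add: dist_norm norm_minus_commute)
    ultimately show ?thesis using that order_trans by blast
  qed
  \<comment> \<open>The positive part of \<open>M\<close> keeps \<open>B\<close>
    nonnegative.\<close>
  define M' where "M' = max M 0"
  define n where "n = sqrt DIM(real ^ 'n)"
  \<comment> \<open>A point at distance at least \<delta> is at least \<delta> / 2 away in space or
    in time; the factor \<open>n\<close> converts the Euclidean norm into the maximum norm.\<close>
  define r where "r = \<delta> / (2 * n)"
  define B where "B = 2 * M' / \<delta>"
  \<comment> \<open>\<open>K\<close> strictly exceeds \<open>B / (p - 1)\<close>, and the second
    entry of the maximum defining \<open>A\<close> makes \<open>(A * exp (- D)) powr (q - 1)\<close>
    at least \<open>K\<close>.\<close>
  define K where "K = B / (p - 1) + 1"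
  define A where "A = max (M' / r + 1) (K powr (1 / (q - 1)) * exp D)"
  have n: "n > 0" by (simp add: n_def)
  have r: "r > 0" using \<delta> n by (simp add: r_def)
  have M': "M' \<ge> 0" "M \<le> M'" by (auto simp: M'_def)
  have B: "B \<ge> 0" using M' \<delta> by (simp add: B_def)
  have K: "K > 0" using B pq by (simp add: K_def add_nonneg_pos)
  have "M' / r + 1 \<le> A" by (simp add: A_def)
  moreover have "M' / r \<ge> 0" using M' r by simp
  ultimately have A: "A > 0" "M' / r \<le> A" by linarith+
  have Ar: "M' \<le> A * r" using A r by (simp add: field_simps)
  have "B < (p - 1) * (A * exp (- norm (fst \<eta> - fst \<zeta>))) powr (q - 1)" if "\<eta> \<in> \<Theta>" for \<eta>
  proof -
    have "K powr (1 / (q - 1)) * exp D * exp (- D) \<le> A * exp (- D)"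
      by (intro mult_right_mono) (auto simp: A_def)
    also have "\<dots> \<le> A * exp (- norm (fst \<eta> - fst \<zeta>))"
      using D[OF that] A by (intro mult_left_mono) auto
    finally have "K powr (1 / (q - 1)) \<le> A * exp (- norm (fst \<eta> - fst \<zeta>))"
      by (simp add: mult.assoc flip: exp_add)
    then have "(K powr (1 / (q - 1))) powr (q - 1) \<le> (A * exp (- norm (fst \<eta> - fst \<zeta>))) powr (q - 1)"
      using pq by (intro powr_mono2) auto
    then have "K \<le> (A * exp (- norm (fst \<eta> - fst \<zeta>))) powr (q - 1)"
      using pq K by (simp add: powr_powr)
    moreover have "B < (p - 1) * K" using pq by (simp add: K_def distrib_left)
    ultimately show ?thesis
      using pq by (meson diff_gt_0_iff_gt less_le_trans mult_le_cancel_left_pos)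
  qed
  then have "steep p q \<Theta> \<zeta> A B" using A B by (simp add: steep_def)
  moreover have "bowl A B \<zeta> \<eta> \<ge> M" if \<eta>: "dist \<eta> \<zeta> \<ge> \<delta>" for \<eta>
  proof -
    let ?x = "fst \<eta> - fst \<zeta>"
    let ?s = "snd \<eta> - snd \<zeta>"
    have "infnorm ?x \<le> exp (infnorm ?x) - 1"
      using exp_ge_add_one_self[of "infnorm ?x"] by linarith
    then have x: "A * infnorm ?x \<le> A * (exp (infnorm ?x) - 1)"
      using A by (intro mult_left_mono) auto
    have nn: "0 \<le> A * infnorm ?x" "0 \<le> B * \<bar>?s\<bar>" using A B by (auto simp: infnorm_pos_le)
    have "dist \<eta> \<zeta> \<le> norm ?x + \<bar>?s\<bar>"
      using sqrt_sum_squares_le_sum[of "norm ?x" "\<bar>?s\<bar>"] by (simp add: dist_prod_def dist_norm)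
    with \<eta> consider "norm ?x \<ge> \<delta> / 2" | "\<bar>?s\<bar> \<ge> \<delta> / 2" by linarith
    then have "M' \<le> A * infnorm ?x + B * \<bar>?s\<bar>"
    proof cases
      case 1
      have "norm ?x \<le> n * infnorm ?x" using norm_le_infnorm[of ?x] by (simp add: n_def)
      with 1 have "r \<le> infnorm ?x" using n by (simp add: r_def field_simps)
      then have "A * r \<le> A * infnorm ?x" using A by simp
      then show ?thesis using Ar nn by linarith
    next
      case 2
      then have "B * (\<delta> / 2) \<le> B * \<bar>?s\<bar>" using B by (intro mult_left_mono) auto
      moreover have "B * (\<delta> / 2) = M'" using \<delta> by (simp add: B_def)
      ultimately show ?thesis using nn by linarith
    qed
    then show ?thesis using x M' by (simp add: bowl_def)
  qed
  ultimately show ?thesis by (rule that)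
qed

text \<open>Within distance \<delta> the function \<open>f\<close> varies by less than
  \<open>e\<close> on \<open>C\<close>; beyond it the bowl is at least \<open>2 * M\<close>. Since
  \<open>f\<close> is bounded by \<open>M\<close> in absolute value, \<open>2 * M\<close> covers
  both the oscillation of \<open>f\<close> and the step from \<open>f \<zeta>\<close> to
  \<open>M\<close> or \<open>- M\<close>.\<close>

lemma bowl_bracket:
  fixes \<Theta> :: "((real ^ 'n) \<times> real) set"
  assumes pq: "p > 1" "q > 1" and \<Theta>: "bounded \<Theta>" and C: "compact C" "continuous_on C f" "\<zeta> \<in> C"
    and e: "e > 0" and N: "open N" "\<zeta> \<in> N"
  obtains A B \<delta> M where "steep p q \<Theta> \<zeta> A B" "cball \<zeta> \<delta> \<subseteq> N"
    "\<And>\<xi>. \<xi> \<in> C \<Longrightarrow> \<bar>f \<xi>\<bar> \<le> M"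
    "\<And>\<xi>. \<xi> \<in> C \<Longrightarrow> f \<xi> \<le> f \<zeta> + e + bowl A B \<zeta> \<xi>"
    "\<And>\<xi>. \<xi> \<in> C \<Longrightarrow> f \<zeta> - e - bowl A B \<zeta> \<xi> \<le> f \<xi>"
    "\<And>\<xi>. \<xi> \<notin> cball \<zeta> \<delta> \<Longrightarrow> M \<le> f \<zeta> + e + bowl A B \<zeta> \<xi>"
    "\<And>\<xi>. \<xi> \<notin> cball \<zeta> \<delta> \<Longrightarrow> f \<zeta> - e - bowl A B \<zeta> \<xi> \<le> - M"
proof -
  have "bounded (f ` C)" using C by (intro compact_imp_bounded compact_continuous_image)
  then obtain M where M: "\<And>\<xi>. \<xi> \<in> C \<Longrightarrow> \<bar>f \<xi>\<bar> \<le> M" by (auto simp: bounded_iff)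
  obtain \<delta>1 where \<delta>1: "\<delta>1 > 0" "cball \<zeta> \<delta>1 \<subseteq> N" using N open_contains_cball by blast
  obtain \<delta>2 where \<delta>2: "\<delta>2 > 0" "\<And>\<xi>. \<xi> \<in> C \<Longrightarrow> dist \<xi> \<zeta> < \<delta>2 \<Longrightarrow> dist (f \<xi>) (f \<zeta>) < e"
    using C e unfolding continuous_on_iff by blast
  define \<delta> where "\<delta> = min \<delta>1 \<delta>2"
  have \<delta>: "\<delta> > 0" "\<delta> \<le> \<delta>1" "\<delta> \<le> \<delta>2" using \<delta>1 \<delta>2 by (auto simp: \<delta>_def)
  obtain A B where st: "steep p q \<Theta> \<zeta> A B"
    and big: "\<And>\<eta>. dist \<eta> \<zeta> \<ge> \<delta> \<Longrightarrow> bowl A B \<zeta> \<eta> \<ge> 2 * M"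
    by (rule exists_steep_bowl[OF pq \<Theta> \<delta>(1), where \<zeta>=\<zeta> and M="2 * M"]) blast
  have nn: "bowl A B \<zeta> \<eta> \<ge> 0" for \<eta> using st by (intro bowl_nonneg) (auto simp: steep_def)
  have f\<zeta>: "\<bar>f \<zeta>\<bar> \<le> M" using M C by blast
  have near: "\<bar>f \<xi> - f \<zeta>\<bar> \<le> e + bowl A B \<zeta> \<xi>" if \<xi>: "\<xi> \<in> C" for \<xi>
  proof (cases "dist \<xi> \<zeta> < \<delta>")
    case True
    then show ?thesis using \<delta>2(2)[OF \<xi>] \<delta> nn[of \<xi>] by (simp add: dist_real_def)
  next
    case False
    then show ?thesis using big[of \<xi>] M[OF \<xi>] f\<zeta> e by simp
  qed
  show ?thesis
  proof (rule that[OF st])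
    show "cball \<zeta> \<delta> \<subseteq> N" using \<delta>1(2) \<delta>(2) by (meson order_trans subset_cball)
    show "\<And>\<xi>. \<xi> \<in> C \<Longrightarrow> \<bar>f \<xi>\<bar> \<le> M" by (rule M)
    show "f \<xi> \<le> f \<zeta> + e + bowl A B \<zeta> \<xi>" "f \<zeta> - e - bowl A B \<zeta> \<xi> \<le> f \<xi>" if "\<xi> \<in> C" for \<xi>
      using near[OF that] by linarith+
    show "M \<le> f \<zeta> + e + bowl A B \<zeta> \<xi>" "f \<zeta> - e - bowl A B \<zeta> \<xi> \<le> - M" if "\<xi> \<notin> cball \<zeta> \<delta>" for \<xi>
    proof -
      have "bowl A B \<zeta> \<xi> \<ge> 2 * M" using that by (intro big) (simp add: dist_commute)
      then show "M \<le> f \<zeta> + e + bowl A B \<zeta> \<xi>" "f \<zeta> - e - bowl A B \<zeta> \<xi> \<le> - M"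
        using f\<zeta> e by linarith+
    qed
  qed
qed

lemma frontier_Int_nhd:
  assumes "open \<Theta>" "open N" "\<xi> \<in> N"
  shows "\<xi> \<in> frontier (\<Theta> \<inter> N) \<longleftrightarrow> \<xi> \<in> frontier \<Theta>"
proof -
  have "\<xi> \<in> closure (\<Theta> \<inter> N) \<longleftrightarrow> \<xi> \<in> closure \<Theta>"
    using open_Int_closure_subset[OF assms(2), of \<Theta>] assms(3) closure_mono[of "\<Theta> \<inter> N" \<Theta>]
    by (auto simp: Int_commute)
  then show ?thesis using assms by (auto simp: frontier_def interior_open open_Int)
qed

lemma at_within_Int_nhd: "open N \<Longrightarrow> \<xi> \<in> N \<Longrightarrow> at \<xi> within \<Theta> \<inter> N = at \<xi> within \<Theta>"
  by (rule at_within_nhd[of _ N]) auto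

lemma upper_classD:
  assumes "u \<in> upper_class p q \<Theta> f"
  shows "viscosity_supersolution p q \<Theta> u" "\<exists>m::real. \<forall>\<xi>\<in>\<Theta>. ereal m \<le> u \<xi>"
    "\<xi> \<in> frontier \<Theta> \<Longrightarrow> ereal (f \<xi>) \<le> Liminf (at \<xi> within \<Theta>) u"
  using assms by (auto simp: upper_class_def simp del: split_paired_All)

lemma upper_perron_leI:
  assumes "\<And>u. u \<in> upper_class p q \<Theta>' g \<Longrightarrow> \<exists>v \<in> upper_class p q \<Theta> f. v \<eta> \<le> u \<eta>"
  shows "upper_perron p q \<Theta> f \<eta> \<le> upper_perron p q \<Theta>' g \<eta>"
  unfolding upper_perron_def using assms by (rule INF_mono)

text \<open>The Perron solution is squeezed near \<zeta> between two on the other set, whose limits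
  at \<zeta> are known by regularity and differ from \<open>f \<zeta>\<close> by \<open>e\<close>.
  The data \<open>g\<close> and \<open>h\<close> are continuous on the whole space because the two
  sets have different frontiers.\<close>

lemma regular_point_sandwich:
  assumes reg: "regular_point p q \<Theta>' \<zeta>" and \<zeta>: "\<zeta> \<in> frontier \<Theta>"
    and N: "open N" "\<zeta> \<in> N" "\<Theta> \<inter> N = \<Theta>' \<inter> N"
    and sandwich: "\<And>f e. continuous_on (frontier \<Theta>) f \<Longrightarrow> e > 0 \<Longrightarrow>
      \<exists>g h. continuous_on UNIV g \<and> continuous_on UNIV h \<and> g \<zeta> = f \<zeta> + e \<and> h \<zeta> = f \<zeta> - e \<and>
        (\<forall>\<eta>\<in>\<Theta> \<inter> N. upper_perron p q \<Theta> f \<eta> \<le> upper_perron p q \<Theta>' g \<eta> \<and>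
          upper_perron p q \<Theta>' h \<eta> \<le> upper_perron p q \<Theta> f \<eta>)"
  shows "regular_point p q \<Theta> \<zeta>"
proof -
  have at: "at \<zeta> within \<Theta>' = at \<zeta> within \<Theta>"
    using at_within_Int_nhd[OF N(1,2)] N(3) by metis
  have in_N: "\<forall>\<^sub>F \<eta> in at \<zeta> within \<Theta>. \<eta> \<in> \<Theta> \<inter> N"
    using N by (auto simp: eventually_at_topological)
  have lim: "(upper_perron p q \<Theta>' g \<longlongrightarrow> ereal (g \<zeta>)) (at \<zeta> within \<Theta>)" if "continuous_on UNIV g" for g
    using reg continuous_on_subset[OF that, of "frontier \<Theta>'"] unfolding regular_point_def at by blast
  have "(upper_perron p q \<Theta> f \<longlongrightarrow> ereal (f \<zeta>)) (at \<zeta> within \<Theta>)" if f: "continuous_on (frontier \<Theta>) f" for f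
  proof (rule order_tendstoI)
    fix a assume "a < ereal (f \<zeta>)"
    then obtain z where z: "a < ereal z" "z < f \<zeta>" using ereal_dense2 by force
    obtain h where h: "continuous_on UNIV h" "h \<zeta> = z"
      "\<And>\<eta>. \<eta> \<in> \<Theta> \<inter> N \<Longrightarrow> upper_perron p q \<Theta>' h \<eta> \<le> upper_perron p q \<Theta> f \<eta>"
      \<comment> \<open>This choice of \<open>e\<close> makes \<open>h \<zeta>\<close> equal to
        \<open>z\<close>, strictly between \<open>a\<close> and \<open>f \<zeta>\<close>.\<close>
      using sandwich[OF f, of "f \<zeta> - z"] z by auto
    from lim[OF h(1)] have "\<forall>\<^sub>F \<eta> in at \<zeta> within \<Theta>. a < upper_perron p q \<Theta>' h \<eta>"
      by (rule order_tendstoD) (simp add: h z)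
    with in_N show "\<forall>\<^sub>F \<eta> in at \<zeta> within \<Theta>. a < upper_perron p q \<Theta> f \<eta>"
      by eventually_elim (rule less_le_trans[OF _ h(3)])
  next
    fix a assume "ereal (f \<zeta>) < a"
    then obtain z where z: "ereal z < a" "f \<zeta> < z" using ereal_dense2 by force
    obtain g where g: "continuous_on UNIV g" "g \<zeta> = z"
      "\<And>\<eta>. \<eta> \<in> \<Theta> \<inter> N \<Longrightarrow> upper_perron p q \<Theta> f \<eta> \<le> upper_perron p q \<Theta>' g \<eta>"
      using sandwich[OF f, of "z - f \<zeta>"] z by auto
    from lim[OF g(1)] have "\<forall>\<^sub>F \<eta> in at \<zeta> within \<Theta>. upper_perron p q \<Theta>' g \<eta> < a"
      by (rule order_tendstoD) (simp add: g z)
    with in_N show "\<forall>\<^sub>F \<eta> in at \<zeta> within \<Theta>. upper_perron p q \<Theta> f \<eta> < a"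
      by eventually_elim (rule le_less_trans[OF g(3)])
  qed
  then show ?thesis using \<zeta> by (simp add: regular_point_def)
qed

lemma continuous_on_add_bowl:
  "continuous_on UNIV (\<lambda>\<eta>. a + bowl A B \<zeta> \<eta>)" "continuous_on UNIV (\<lambda>\<eta>. a - bowl A B \<zeta> \<eta>)"
  by (intro continuous_intros continuous_on_bowl)+

lemma isCont_add_bowl:
  "isCont (\<lambda>\<eta>. a + bowl A B \<zeta> \<eta>) \<xi>" "isCont (\<lambda>\<eta>. a - bowl A B \<zeta> \<eta>) \<xi>"
  using continuous_on_add_bowl[of a A B \<zeta>] unfolding continuous_on_eq_continuous_at[OF open_UNIV] by blast+

section \<open>The two implications, for an arbitrary open neighbourhood \<open>N\<close> of
  \<zeta>\<close>

text \<open>Supersolutions on \<Theta> restrict and give the upper bound; for the lower bound a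
  supersolution on the smaller set is extended to \<Theta> by pasting it with the negative bowl
  \<open>?h\<close>.\<close>

lemma regular_point_Int_nhd:
  assumes pq: "p > 1" "q > 1" and \<Theta>: "open \<Theta>" "bounded \<Theta>" and N: "open N" "\<zeta> \<in> N"
    and reg: "regular_point p q \<Theta> \<zeta>"
  shows "regular_point p q (\<Theta> \<inter> N) \<zeta>"
proof (rule regular_point_sandwich[OF reg])
  have \<zeta>: "\<zeta> \<in> frontier \<Theta>" using reg by (simp add: regular_point_def)
  then show \<zeta>': "\<zeta> \<in> frontier (\<Theta> \<inter> N)" using frontier_Int_nhd[OF \<Theta>(1) N] by simp
  show "open N" "\<zeta> \<in> N" "\<Theta> \<inter> N \<inter> N = \<Theta> \<inter> N" using N by auto
  fix f :: "(real ^ 'a) \<times> real \<Rightarrow> real" and e :: real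
  assume f: "continuous_on (frontier (\<Theta> \<inter> N)) f" and e: "e > 0"
  have \<Theta>N: "open (\<Theta> \<inter> N)" "bounded (\<Theta> \<inter> N)" using \<Theta> N by (auto simp: bounded_Int)
  obtain A B \<delta> M where st: "steep p q \<Theta> \<zeta> A B" and \<delta>: "cball \<zeta> \<delta> \<subseteq> N"
    and M: "\<And>\<xi>. \<xi> \<in> frontier (\<Theta> \<inter> N) \<Longrightarrow> \<bar>f \<xi>\<bar> \<le> M"
    and f_le: "\<And>\<xi>. \<xi> \<in> frontier (\<Theta> \<inter> N) \<Longrightarrow> f \<xi> \<le> f \<zeta> + e + bowl A B \<zeta> \<xi>"
    and le_f: "\<And>\<xi>. \<xi> \<in> frontier (\<Theta> \<inter> N) \<Longrightarrow> f \<zeta> - e - bowl A B \<zeta> \<xi> \<le> f \<xi>"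
    and far: "\<And>\<xi>. \<xi> \<notin> cball \<zeta> \<delta> \<Longrightarrow> f \<zeta> - e - bowl A B \<zeta> \<xi> \<le> - M"
    by (rule bowl_bracket[OF pq \<Theta>(2) compact_frontier_bounded[OF \<Theta>N(2)] f \<zeta>' e N]) blast
  let ?g = "\<lambda>\<eta>. f \<zeta> + e + bowl A B \<zeta> \<eta>"
  let ?h = "\<lambda>\<eta>. f \<zeta> - e - bowl A B \<zeta> \<eta>"
  have upper: "upper_perron p q (\<Theta> \<inter> N) f \<eta> \<le> upper_perron p q \<Theta> ?g \<eta>" for \<eta>
  proof (rule upper_perron_leI)
    fix u assume u: "u \<in> upper_class p q \<Theta> ?g"
    obtain m where m: "\<And>\<eta>. \<eta> \<in> \<Theta> \<Longrightarrow> ereal m \<le> u \<eta>" using upper_classD(2)[OF u] by blast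
    \<comment> \<open>Part of the frontier of \<Theta> \<inter> \<open>N\<close> may lie inside
      \<Theta>, where membership in \<open>upper_class\<close> for \<Theta> gives no boundary value.
      Comparison carries the bound by \<open>?g\<close> into the interior and so to these
      points.\<close>
    have ge: "ereal (?g \<eta>) \<le> u \<eta>" if "\<eta> \<in> \<Theta>" for \<eta>
      by (rule viscosity_supersolution_ge_bowl[OF pq \<Theta> upper_classD(1)[OF u] m st upper_classD(3)[OF u] that])
    have "ereal (f \<xi>) \<le> Liminf (at \<xi> within \<Theta> \<inter> N) u" if "\<xi> \<in> frontier (\<Theta> \<inter> N)" for \<xi>
    proof -
      have "ereal (f \<xi>) \<le> ereal (?g \<xi>)" using f_le[OF that] by simp
      also have "\<dots> \<le> Liminf (at \<xi> within \<Theta> \<inter> N) u"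
        using ge by (intro le_Liminf_of_continuous isCont_add_bowl) (auto simp: eventually_at_filter)
      finally show ?thesis .
    qed
    moreover have "viscosity_supersolution p q (\<Theta> \<inter> N) u"
      using upper_classD(1)[OF u] \<Theta>(1) \<Theta>N(1) by (rule viscosity_supersolution_subset) auto
    ultimately have "u \<in> upper_class p q (\<Theta> \<inter> N) f"
      using m unfolding upper_class_def by blast
    then show "\<exists>v\<in>upper_class p q (\<Theta> \<inter> N) f. v \<eta> \<le> u \<eta>" by blast
  qed
  have lower: "upper_perron p q \<Theta> ?h \<eta> \<le> upper_perron p q (\<Theta> \<inter> N) f \<eta>" if \<eta>: "\<eta> \<in> \<Theta> \<inter> N" for \<eta>
  proof (rule upper_perron_leI)
    fix u assume u: "u \<in> upper_class p q (\<Theta> \<inter> N) f"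
    obtain m where m: "\<And>\<eta>. \<eta> \<in> \<Theta> \<inter> N \<Longrightarrow> ereal m \<le> u \<eta>" using upper_classD(2)[OF u] by blast
    have ge: "ereal (- M) \<le> u \<eta>" if "\<eta> \<in> \<Theta> \<inter> N" for \<eta>
    proof (rule viscosity_supersolution_ge_const[OF pq \<Theta>N upper_classD(1)[OF u] m _ that])
      fix \<xi> assume \<xi>: "\<xi> \<in> frontier (\<Theta> \<inter> N)"
      have "ereal (- M) \<le> ereal (f \<xi>)" using M[OF \<xi>] by simp
      also have "\<dots> \<le> Liminf (at \<xi> within \<Theta> \<inter> N) u" by (rule upper_classD(3)[OF u \<xi>])
      finally show "ereal (- M) \<le> Liminf (at \<xi> within \<Theta> \<inter> N) u" .
    qed
    \<comment> \<open>Beyond \<delta> the bowl has pushed \<open>?h\<close> below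
      \<open>- M\<close>, while \<open>u\<close> stays above \<open>- M\<close> by comparison; so
      \<open>?h\<close> is the smaller one in the collar, as pasting requires.\<close>
    have h_le: "ereal (?h \<eta>) \<le> u \<eta>" if "\<eta> \<in> \<Theta> \<inter> N - cball \<zeta> \<delta>" for \<eta>
    proof -
      have "ereal (?h \<eta>) \<le> ereal (- M)" using far[of \<eta>] that by simp
      also have "\<dots> \<le> u \<eta>" using ge that by blast
      finally show ?thesis .
    qed
    define v where "v \<eta> = (if \<eta> \<in> N then min (u \<eta>) (ereal (?h \<eta>)) else ereal (?h \<eta>))" for \<eta>
    have v_super: "viscosity_supersolution p q \<Theta> v"
      unfolding v_def
      by (rule viscosity_supersolution_paste[OF \<Theta>(1) N(1) closed_cball \<delta> upper_classD(1)[OF u]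
            viscosity_supersolution_bowl[OF pq \<Theta>(1) st] h_le])
    have v_far: "v \<eta> = ereal (?h \<eta>)" if "\<eta> \<in> \<Theta>" "\<eta> \<notin> cball \<zeta> \<delta>" for \<eta>
      using h_le[of \<eta>] that by (auto simp: v_def)
    have "ereal (?h \<xi>) \<le> Liminf (at \<xi> within \<Theta>) v" if \<xi>: "\<xi> \<in> frontier \<Theta>" for \<xi>
    proof (cases "\<xi> \<in> N")
      case True
      then have \<xi>': "\<xi> \<in> frontier (\<Theta> \<inter> N)" using \<xi> frontier_Int_nhd[OF \<Theta>(1) N(1)] by blast
      have "ereal (?h \<xi>) \<le> ereal (f \<xi>)" using le_f[OF \<xi>'] by simp
      also have "\<dots> \<le> Liminf (at \<xi> within \<Theta>) u"
        using upper_classD(3)[OF u \<xi>'] at_within_Int_nhd[OF N(1) True] by metis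
      finally have 1: "ereal (?h \<xi>) \<le> Liminf (at \<xi> within \<Theta>) u" .
      have 2: "ereal (?h \<xi>) \<le> Liminf (at \<xi> within \<Theta>) (\<lambda>\<eta>. ereal (?h \<eta>))"
        by (intro le_Liminf_of_continuous isCont_add_bowl) simp
      show ?thesis
      proof (unfold le_Liminf_iff, intro allI impI)
        fix y assume "y < ereal (?h \<xi>)"
        with 1 2 have "\<forall>\<^sub>F \<eta> in at \<xi> within \<Theta>. y < u \<eta>" "\<forall>\<^sub>F \<eta> in at \<xi> within \<Theta>. y < ereal (?h \<eta>)"
          unfolding le_Liminf_iff by blast+
        then show "\<forall>\<^sub>F \<eta> in at \<xi> within \<Theta>. y < v \<eta>"
          by eventually_elim (simp add: v_def)
      qed
    next
      \<comment> \<open>Here \<xi> has a neighbourhood off the closed ball, in which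
        \<open>v\<close> is \<open>?h\<close> on \<Theta>.\<close>
      case False
      then have "\<xi> \<in> - cball \<zeta> \<delta>" using \<delta> by blast
      then have "\<forall>\<^sub>F \<eta> in at \<xi> within \<Theta>. \<eta> \<in> - cball \<zeta> \<delta>"
        using open_Compl[OF closed_cball] by (auto simp: eventually_at_topological)
      moreover have "\<forall>\<^sub>F \<eta> in at \<xi> within \<Theta>. \<eta> \<in> \<Theta>" by (simp add: eventually_at_filter)
      ultimately have "\<forall>\<^sub>F \<eta> in at \<xi> within \<Theta>. ereal (?h \<eta>) \<le> v \<eta>"
        by eventually_elim (simp add: v_far)
      then show ?thesis by (intro le_Liminf_of_continuous isCont_add_bowl)
    qed
    moreover have "\<exists>m. \<forall>\<eta>\<in>\<Theta>. ereal m \<le> v \<eta>"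
    proof -
      have "bounded (?h ` closure \<Theta>)"
        using \<Theta>(2) continuous_on_subset[OF continuous_on_add_bowl(2) subset_UNIV]
        by (intro compact_imp_bounded compact_continuous_image) (simp_all add: compact_closure)
      then obtain R where R: "\<And>\<eta>. \<eta> \<in> \<Theta> \<Longrightarrow> \<bar>?h \<eta>\<bar> \<le> R"
        using closure_subset[of \<Theta>] by (force simp: bounded_iff)
      have "ereal (min (- M) (- R)) \<le> v \<eta>" if "\<eta> \<in> \<Theta>" for \<eta>
      proof -
        have "min (- M) (- R) \<le> ?h \<eta>" using R[OF that] by linarith
        then have "ereal (min (- M) (- R)) \<le> ereal (?h \<eta>)" by (simp only: ereal_less_eq)
        moreover have "ereal (min (- M) (- R)) \<le> u \<eta>" if "\<eta> \<in> N"
          using ge[of \<eta>] that \<open>\<eta> \<in> \<Theta>\<close> by (intro order_trans[OF _ ge]) auto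
        ultimately show ?thesis by (simp add: v_def)
      qed
      then show ?thesis by blast
    qed
    ultimately have "v \<in> upper_class p q \<Theta> ?h"
      using v_super unfolding upper_class_def by blast
    moreover have "v \<eta> \<le> u \<eta>" using \<eta> by (simp add: v_def)
    ultimately show "\<exists>v\<in>upper_class p q \<Theta> ?h. v \<eta> \<le> u \<eta>" by blast
  qed
  show "\<exists>g h. continuous_on UNIV g \<and> continuous_on UNIV h \<and> g \<zeta> = f \<zeta> + e \<and> h \<zeta> = f \<zeta> - e \<and>
        (\<forall>\<eta>\<in>\<Theta> \<inter> N \<inter> N. upper_perron p q (\<Theta> \<inter> N) f \<eta> \<le> upper_perron p q \<Theta> g \<eta> \<and>
          upper_perron p q \<Theta> h \<eta> \<le> upper_perron p q (\<Theta> \<inter> N) f \<eta>)"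
    using upper lower
    by (intro exI[of _ ?g] exI[of _ ?h] conjI continuous_on_add_bowl) auto
qed

text \<open>The roles are exchanged: the upper bound now needs pasting, with the constant
  \<open>M\<close>, which dominates \<open>f\<close> on the frontier of \<Theta>; the lower bound
  comes from restriction.\<close>

lemma regular_point_Int_nhd_imp:
  assumes pq: "p > 1" "q > 1" and \<Theta>: "open \<Theta>" "bounded \<Theta>" and N: "open N" "\<zeta> \<in> N"
    and reg: "regular_point p q (\<Theta> \<inter> N) \<zeta>"
  shows "regular_point p q \<Theta> \<zeta>"
proof (rule regular_point_sandwich[OF reg])
  have \<zeta>': "\<zeta> \<in> frontier (\<Theta> \<inter> N)" using reg by (simp add: regular_point_def)
  then show \<zeta>: "\<zeta> \<in> frontier \<Theta>" using frontier_Int_nhd[OF \<Theta>(1) N] by simp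
  show "open N" "\<zeta> \<in> N" "\<Theta> \<inter> N = \<Theta> \<inter> N \<inter> N" using N by auto
  fix f :: "(real ^ 'a) \<times> real \<Rightarrow> real" and e :: real
  assume f: "continuous_on (frontier \<Theta>) f" and e: "e > 0"
  have \<Theta>N: "open (\<Theta> \<inter> N)" "bounded (\<Theta> \<inter> N)" using \<Theta> N by (auto simp: bounded_Int)
  obtain A B \<delta> M where st: "steep p q \<Theta> \<zeta> A B" and \<delta>: "cball \<zeta> \<delta> \<subseteq> N"
    and M: "\<And>\<xi>. \<xi> \<in> frontier \<Theta> \<Longrightarrow> \<bar>f \<xi>\<bar> \<le> M"
    and f_le: "\<And>\<xi>. \<xi> \<in> frontier \<Theta> \<Longrightarrow> f \<xi> \<le> f \<zeta> + e + bowl A B \<zeta> \<xi>"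
    and le_f: "\<And>\<xi>. \<xi> \<in> frontier \<Theta> \<Longrightarrow> f \<zeta> - e - bowl A B \<zeta> \<xi> \<le> f \<xi>"
    and far: "\<And>\<xi>. \<xi> \<notin> cball \<zeta> \<delta> \<Longrightarrow> M \<le> f \<zeta> + e + bowl A B \<zeta> \<xi>"
      "\<And>\<xi>. \<xi> \<notin> cball \<zeta> \<delta> \<Longrightarrow> f \<zeta> - e - bowl A B \<zeta> \<xi> \<le> - M"
    by (rule bowl_bracket[OF pq \<Theta>(2) compact_frontier_bounded[OF \<Theta>(2)] f \<zeta> e N]) blast
  have AB: "A > 0" "B \<ge> 0" using st by (auto simp: steep_def)
  let ?g = "\<lambda>\<eta>. f \<zeta> + e + bowl A B \<zeta> \<eta>"
  let ?h = "\<lambda>\<eta>. f \<zeta> - e - bowl A B \<zeta> \<eta>"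
  have upper: "upper_perron p q \<Theta> f \<eta> \<le> upper_perron p q (\<Theta> \<inter> N) ?g \<eta>" if \<eta>: "\<eta> \<in> \<Theta> \<inter> N" for \<eta>
  proof (rule upper_perron_leI)
    fix u assume u: "u \<in> upper_class p q (\<Theta> \<inter> N) ?g"
    obtain m where m: "\<And>\<eta>. \<eta> \<in> \<Theta> \<inter> N \<Longrightarrow> ereal m \<le> u \<eta>" using upper_classD(2)[OF u] by blast
    have st': "steep p q (\<Theta> \<inter> N) \<zeta> A B" using st by (rule steep_subset) simp
    have ge: "ereal (?g \<eta>) \<le> u \<eta>" if "\<eta> \<in> \<Theta> \<inter> N" for \<eta>
      by (rule viscosity_supersolution_ge_bowl[OF pq \<Theta>N upper_classD(1)[OF u] m st' upper_classD(3)[OF u] that])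
    \<comment> \<open>In the collar \<open>?g\<close> is at least \<open>M\<close>, and
      \<open>u\<close> lies above \<open>?g\<close>; so the minimum of \<open>u\<close> and
      \<open>M\<close> is \<open>M\<close> there.\<close>
    have M_le: "ereal M \<le> u \<eta>" if "\<eta> \<in> \<Theta> \<inter> N - cball \<zeta> \<delta>" for \<eta>
      using far(1)[of \<eta>] that by (intro order_trans[OF _ ge]) auto
    define v where "v \<eta> = (if \<eta> \<in> N then min (u \<eta>) (ereal M) else ereal M)" for \<eta>
    have v_super: "viscosity_supersolution p q \<Theta> v"
      unfolding v_def
      by (rule viscosity_supersolution_paste[OF \<Theta>(1) N(1) closed_cball \<delta> upper_classD(1)[OF u]
            viscosity_supersolution_const[OF \<Theta>(1)] M_le])
    \<comment> \<open>The continuous lower bound \<open>min ?g M\<close> dominates \<open>f\<close>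
      on the whole frontier, so the boundary condition follows without separating points of
      \<open>N\<close> from the others.\<close>
    have v_ge: "ereal (min (?g \<eta>) M) \<le> v \<eta>" if "\<eta> \<in> \<Theta>" for \<eta>
    proof (cases "\<eta> \<in> N")
      case True
      then have "ereal (min (?g \<eta>) M) \<le> u \<eta>" using that by (intro order_trans[OF _ ge]) auto
      then show ?thesis using True by (simp add: v_def)
    qed (simp add: v_def)
    have "ereal (f \<xi>) \<le> Liminf (at \<xi> within \<Theta>) v" if \<xi>: "\<xi> \<in> frontier \<Theta>" for \<xi>
    proof -
      have "ereal (f \<xi>) \<le> ereal (min (?g \<xi>) M)" using f_le[OF \<xi>] M[OF \<xi>] by simp
      also have "\<dots> \<le> Liminf (at \<xi> within \<Theta>) v"
        using v_ge
        by (intro le_Liminf_of_continuous continuous_min isCont_add_bowl continuous_const)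
          (auto simp: eventually_at_filter)
      finally show ?thesis .
    qed
    moreover have "\<exists>m. \<forall>\<eta>\<in>\<Theta>. ereal m \<le> v \<eta>"
    proof -
      have "ereal (min (f \<zeta> + e) M) \<le> v \<eta>" if "\<eta> \<in> \<Theta>" for \<eta>
      proof -
        have "min (f \<zeta> + e) M \<le> min (?g \<eta>) M"
          using bowl_nonneg[of A B \<zeta> \<eta>] AB by (intro min.mono) auto
        then have "ereal (min (f \<zeta> + e) M) \<le> ereal (min (?g \<eta>) M)" by (simp only: ereal_less_eq)
        then show ?thesis using v_ge[OF that] by (rule order_trans)
      qed
      then show ?thesis by blast
    qed
    ultimately have "v \<in> upper_class p q \<Theta> f"
      using v_super unfolding upper_class_def by blast
    moreover have "v \<eta> \<le> u \<eta>" using \<eta> by (simp add: v_def)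
    ultimately show "\<exists>v\<in>upper_class p q \<Theta> f. v \<eta> \<le> u \<eta>" by blast
  qed
  have lower: "upper_perron p q (\<Theta> \<inter> N) ?h \<eta> \<le> upper_perron p q \<Theta> f \<eta>" for \<eta>
  proof (rule upper_perron_leI)
    fix u assume u: "u \<in> upper_class p q \<Theta> f"
    obtain m where m: "\<And>\<eta>. \<eta> \<in> \<Theta> \<Longrightarrow> ereal m \<le> u \<eta>" using upper_classD(2)[OF u] by blast
    have ge: "ereal (- M) \<le> u \<eta>" if "\<eta> \<in> \<Theta>" for \<eta>
    proof (rule viscosity_supersolution_ge_const[OF pq \<Theta> upper_classD(1)[OF u] m _ that])
      fix \<xi> assume \<xi>: "\<xi> \<in> frontier \<Theta>"
      have "ereal (- M) \<le> ereal (f \<xi>)" using M[OF \<xi>] by simp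
      also have "\<dots> \<le> Liminf (at \<xi> within \<Theta>) u" by (rule upper_classD(3)[OF u \<xi>])
      finally show "ereal (- M) \<le> Liminf (at \<xi> within \<Theta>) u" .
    qed
    \<comment> \<open>A frontier point of \<Theta> \<inter> \<open>N\<close> in the closed ball is a
      frontier point of \<Theta>, where \<open>f\<close> controls \<open>u\<close>. Any other one
      may lie inside \<Theta> and is covered by \<open>?h\<close> \<le> \<open>- M\<close> \<le>
      \<open>u\<close>.\<close>
    have "ereal (?h \<xi>) \<le> Liminf (at \<xi> within \<Theta> \<inter> N) u" if \<xi>: "\<xi> \<in> frontier (\<Theta> \<inter> N)" for \<xi>
    proof (cases "\<xi> \<in> cball \<zeta> \<delta>")
      case True
      then have \<xi>N: "\<xi> \<in> N" using \<delta> by blast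
      then have \<xi>': "\<xi> \<in> frontier \<Theta>" using \<xi> frontier_Int_nhd[OF \<Theta>(1) N(1)] by blast
      have "ereal (?h \<xi>) \<le> ereal (f \<xi>)" using le_f[OF \<xi>'] by simp
      also have "\<dots> \<le> Liminf (at \<xi> within \<Theta> \<inter> N) u"
        using upper_classD(3)[OF u \<xi>'] at_within_Int_nhd[OF N(1) \<xi>N] by metis
      finally show ?thesis .
    next
      case False
      then have "ereal (?h \<xi>) \<le> ereal (- M)" using far(2) by simp
      also have "\<dots> \<le> Liminf (at \<xi> within \<Theta> \<inter> N) u"
        using ge by (intro Liminf_bounded) (auto simp: eventually_at_filter)
      finally show ?thesis .
    qed
    moreover have "viscosity_supersolution p q (\<Theta> \<inter> N) u"
      using upper_classD(1)[OF u] \<Theta>(1) \<Theta>N(1) by (rule viscosity_supersolution_subset) auto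
    ultimately have "u \<in> upper_class p q (\<Theta> \<inter> N) ?h"
      using m unfolding upper_class_def by blast
    then show "\<exists>v\<in>upper_class p q (\<Theta> \<inter> N) ?h. v \<eta> \<le> u \<eta>" by blast
  qed
  show "\<exists>g h. continuous_on UNIV g \<and> continuous_on UNIV h \<and> g \<zeta> = f \<zeta> + e \<and> h \<zeta> = f \<zeta> - e \<and>
        (\<forall>\<eta>\<in>\<Theta> \<inter> N. upper_perron p q \<Theta> f \<eta> \<le> upper_perron p q (\<Theta> \<inter> N) g \<eta> \<and>
          upper_perron p q (\<Theta> \<inter> N) h \<eta> \<le> upper_perron p q \<Theta> f \<eta>)"
    using upper lower
    by (intro exI[of _ ?g] exI[of _ ?h] conjI continuous_on_add_bowl) auto
qed

theorem proposition5p8: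
  fixes \<Theta> :: "((real ^ 'n) \<times> real) set" and \<xi>0 c :: "(real ^ 'n) \<times> real" and p q r :: real
  assumes "p > 1" and "q > 1"
    and "open \<Theta>" and "bounded \<Theta>"
    and "\<xi>0 \<in> frontier \<Theta>"
    and "\<xi>0 \<in> ball c r"
  shows "regular_point p q \<Theta> \<xi>0 \<longleftrightarrow> regular_point p q (\<Theta> \<inter> ball c r) \<xi>0"
  using regular_point_Int_nhd[OF assms(1-4) open_ball assms(6)]
    regular_point_Int_nhd_imp[OF assms(1-4) open_ball assms(6)] by blast

end
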